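(* Let $\mathcal A$ be an arrangement of $n$ hyperplanes of rank $r$ in a finite-dimensional complex vector space $V$. Then $$\mathrm{Hilb}(C_{\mathcal A,-2};q)=q^{n-r}\,T_{\mathcal A}\!\left(0,\frac1q\right).$$
   Context: $\mathbb C[V^*]$ denotes the algebra of polynomial functions on $V$. A (central) arrangement $\mathcal A=\{H_1,\dots,H_n\}$ in $V$ is a finite collection (repetitions allowed) of hyperplanes $H_i=\{l_i=0\}$ with $l_i\in V^*$; the degenerate case $l_i=0$ (a loop) is allowed. Its matroid is the linear matroid of $l_1,\dots,l_n$ with rank function $r(\cdot)$; the rank of $\mathcal A$ is $r=\dim\mathrm{span}(l_1,\dots,l_n)$. For nonzero $h\in V$, $\rho_{\mathcal A}(h)$ is the number of hyperplanes of $\mathcal A$ not containing $h$, i.e. the number of $i$ with $l_i(h)\neq 0$. $C_{\mathcal A,-2}$ is the space of $f\in\mathbb C[V^*]$ such that for every nonzero $h\in V$ the restriction of $f$ to every affine line of direction $h$ has degree at most $\rho_{\mathcal A}(h)-2$ (only the zero polynomial has negative degree), i.e. the $(\rho_{\mathcal A}(h)-1)$-th power of the directional derivative along $h$ annihilates $f$; it is graded by degree, and $\mathrm{Hilb}(C;q)=\sum_i \dim C_i\,q^i$. The Tutte polynomial is $T_{\mathcal A}(x,y)=\sum_{S\subseteq[n]}(x-1)^{r-r(S)}(y-1)^{|S|-r(S)}$.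
   Formalization: The arrangement is assumed essential (dim V = r); without this the formula fails, e.g. for n = 0 and V = C the space C is 0 while the right side is 1 (if r < dim V, the left side is 0, so the formula survives only as 0 = 0, when there is a coloop). *)

theory Defs
  imports
    "HOL-Library.Function_Algebras"
    "HOL-Computational_Algebra.Polynomial"
    "HOL-Computational_Algebra.Formal_Laurent_Series"
begin

text \<open>
  Throughout, \<open>V\<close> is the type \<open>'v\<close> with scalar multiplication \<open>scale\<close>; an arrangement of \<open>n\<close>
  hyperplanes is given by functionals \<open>l 1, \<dots>, l n\<close>, so repetitions and loops (\<open>l i = 0\<close>) are allowed.
\<close>

definition fun_scale :: "complex \<Rightarrow> ('v \<Rightarrow> complex) \<Rightarrow> 'v \<Rightarrow> complex" where
  "fun_scale c f = (\<lambda>v. c * f v)"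

global_interpretation fun_vs: vector_space fun_scale
  by unfold_locales (simp_all add: fun_scale_def fun_eq_iff algebra_simps)

abbreviation functional :: "(complex \<Rightarrow> 'v::ab_group_add \<Rightarrow> 'v) \<Rightarrow> ('v \<Rightarrow> complex) \<Rightarrow> bool" where
  "functional scale \<equiv> Vector_Spaces.linear scale (*)"

text \<open>Over the infinite field of complex numbers, polynomials on \<open>V\<close> may be identified with the
  functions on \<open>V\<close> that they define.\<close>

inductive_set poly_funs :: "(complex \<Rightarrow> 'v::ab_group_add \<Rightarrow> 'v) \<Rightarrow> ('v \<Rightarrow> complex) set"
  for scale where
  const: "(\<lambda>v. c) \<in> poly_funs scale"
| functional: "functional scale \<phi> \<Longrightarrow> \<phi> \<in> poly_funs scale"
| add: "f \<in> poly_funs scale \<Longrightarrow> g \<in> poly_funs scale \<Longrightarrow> (\<lambda>v. f v + g v) \<in> poly_funs scale"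
| mult: "f \<in> poly_funs scale \<Longrightarrow> g \<in> poly_funs scale \<Longrightarrow> (\<lambda>v. f v * g v) \<in> poly_funs scale"

definition hom_poly_funs :: "(complex \<Rightarrow> 'v::ab_group_add \<Rightarrow> 'v) \<Rightarrow> nat \<Rightarrow> ('v \<Rightarrow> complex) set" where
  "hom_poly_funs scale d =
     fun_vs.span {(\<lambda>v. \<Prod>j<d. \<phi> j v) | \<phi>. \<forall>j<d. functional scale (\<phi> j)}"

definition rk :: "(nat \<Rightarrow> 'v \<Rightarrow> complex) \<Rightarrow> nat set \<Rightarrow> nat" where
  "rk l S = fun_vs.dim (fun_vs.span (l ` S))"

definition \<rho> :: "nat \<Rightarrow> (nat \<Rightarrow> 'v \<Rightarrow> complex) \<Rightarrow> 'v \<Rightarrow> nat" where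
  "\<rho> n l h = card {i \<in> {1..n}. l i h \<noteq> 0}"

text \<open>The space \<open>C\<^sub>\<A>\<^sub>,\<^sub>k\<close>. Only the zero polynomial counts as having negative degree.\<close>

definition C_space ::
  "(complex \<Rightarrow> 'v::ab_group_add \<Rightarrow> 'v) \<Rightarrow> nat \<Rightarrow> (nat \<Rightarrow> 'v \<Rightarrow> complex) \<Rightarrow> int \<Rightarrow> ('v \<Rightarrow> complex) set" where
  "C_space scale n l k =
     {f \<in> poly_funs scale. \<forall>h. h \<noteq> 0 \<longrightarrow> (\<forall>a. \<exists>p :: complex poly.
        (\<forall>t. f (a + scale t h) = poly p t) \<and> (p = 0 \<or> int (degree p) \<le> int (\<rho> n l h) + k))}"

definition Hilb :: "(complex \<Rightarrow> 'v::ab_group_add \<Rightarrow> 'v) \<Rightarrow> ('v \<Rightarrow> complex) set \<Rightarrow> rat fps" where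
  "Hilb scale C = Abs_fps (\<lambda>i. of_nat (fun_vs.dim (C \<inter> hom_poly_funs scale i)))"

definition tutte :: "nat \<Rightarrow> (nat \<Rightarrow> 'v \<Rightarrow> complex) \<Rightarrow> 'a::comm_ring_1 \<Rightarrow> 'a \<Rightarrow> 'a" where
  "tutte n l x y =
     (\<Sum>S\<in>Pow {1..n}. (x - 1) ^ (rk l {1..n} - rk l S) * (y - 1) ^ (card S - rk l S))"

end

theory Submission imports Defs begin

text \<open>
  For \<open>E \<subseteq> A\<close> interpolate between \<open>C\<^sub>A\<^sub>,\<^sub>-\<^sub>1\<close> and \<open>C\<^sub>A\<^sub>,\<^sub>-\<^sub>2\<close> by the space \<open>D(A, E)\<close> of polynomials whose degree
  along \<open>h\<close> is at most \<open>\<rho>\<^sub>A(h) - 2\<close> if some functional in \<open>E\<close> is nonzero at \<open>h\<close>, and at most \<open>\<rho>\<^sub>A(h) - 1\<close> otherwise.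
  For \<open>e \<in> A\<close> there is an exact sequence
  \<open>0 \<rightarrow> D(A, E \<union> {e}) \<rightarrow> D(A, E) \<rightarrow> \<Oplus>\<^sub>F D(F, E) \<rightarrow> 0\<close>,
  the sum being over the hyperplane flats \<open>F \<supseteq> E\<close> with \<open>e \<notin> F\<close>. If the line spanned by \<open>h\<close> is the common
  kernel of \<open>F\<close>, then the map to the summand of \<open>F\<close> takes the coefficient of \<open>t\<close> to the power \<open>\<rho>\<^sub>A(h) - 1\<close> in \<open>f(a + t h)\<close>, which
  lowers the degree by \<open>|A - F| - 1\<close>; multiplication by the functionals in \<open>A - F - {e}\<close> splits it. That the
  coefficient lies in \<open>D(F, E)\<close> is a count of zeros of a polynomial in one variable.

  Since \<open>D(A, {e})\<close> is \<open>D(A - {e}, {})\<close>, or zero if \<open>e\<close> is a coloop, the sequence determines the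
  Hilbert series of all \<open>D(A, E)\<close> by induction. The sum of the terms of \<open>q\<^bsup>n-r\<^esup> T(0, 1/q)\<close> over those \<open>S \<subseteq> A\<close>
  for which \<open>S \<union> E\<close> spans satisfies the same recursion, and for \<open>E = A\<close> it is the Tutte evaluation.
\<close>

subsection \<open>Linear algebra and univariate polynomials\<close>

text \<open>\<open>fun_vs.dim\<close> is 0 on a space of infinite dimension, so finiteness has to be
  carried along as a separate fact wherever dimensions are added.\<close>

definition findim :: "('v \<Rightarrow> complex) set \<Rightarrow> bool" where
  "findim S \<longleftrightarrow> (\<exists>B. finite B \<and> S \<subseteq> fun_vs.span B)"

lemma findim_subset: "findim T \<Longrightarrow> S \<subseteq> T \<Longrightarrow> findim S"
  unfolding findim_def by blast

lemma findim_basis: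
  assumes "findim S"
  obtains B where "B \<subseteq> S" "finite B" "fun_vs.independent B" "S \<subseteq> fun_vs.span B" "card B = fun_vs.dim S"
proof -
  obtain B where B: "B \<subseteq> S" "fun_vs.independent B" "S \<subseteq> fun_vs.span B" "card B = fun_vs.dim S"
    using fun_vs.basis_exists by blast
  moreover have "finite B"
    using assms B(1,2) fun_vs.independent_span_bound unfolding findim_def by blast
  ultimately show thesis using that by blast
qed

lemma findim_span_insert:
  assumes "findim S" "x \<notin> fun_vs.span S"
  shows "findim (fun_vs.span (insert x S))" "fun_vs.dim (fun_vs.span (insert x S)) = Suc (fun_vs.dim S)"
proof -
  obtain B where B: "B \<subseteq> S" "finite B" "fun_vs.independent B" "S \<subseteq> fun_vs.span B" "card B = fun_vs.dim S"
    using findim_basis[OF assms(1)] .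
  have x: "x \<notin> fun_vs.span B" using B(1) assms(2) fun_vs.span_mono by blast
  have sub: "insert x S \<subseteq> fun_vs.span (insert x B)"
    using B(4) fun_vs.span_mono[of B "insert x B"] fun_vs.span_base[of x "insert x B"] by blast
  then have sub': "fun_vs.span (insert x S) \<subseteq> fun_vs.span (insert x B)"
    by (simp add: fun_vs.span_minimal)
  then show "findim (fun_vs.span (insert x S))"
    using B(2) unfolding findim_def by blast
  have "card (insert x B) = Suc (fun_vs.dim S)"
    using B x fun_vs.span_base by (subst card_insert_disjoint) auto
  moreover have "insert x B \<subseteq> fun_vs.span (insert x S)"
    using B(1) fun_vs.span_superset[of "insert x S"] by blast
  ultimately show "fun_vs.dim (fun_vs.span (insert x S)) = Suc (fun_vs.dim S)"
    using sub' fun_vs.independent_insertI[OF x B(3)] fun_vs.dim_unique by blast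
qed

text \<open>Starting from the kernel, lift a basis of \<open>T\<close> one vector at a time: a lift
  \<open>x\<close> of a new basis vector \<open>b\<close> enlarges the preimage of
  \<open>fun_vs.span C\<close> by exactly one dimension. Finiteness of \<open>S\<close> comes out of
  the same induction.\<close>

lemma rank_nullity_on:
  assumes S: "fun_vs.subspace S" and T: "fun_vs.subspace T"
    and \<phi>T: "\<And>f. f \<in> S \<Longrightarrow> \<phi> f \<in> T"
    and add: "\<And>f g. f \<in> S \<Longrightarrow> g \<in> S \<Longrightarrow> \<phi> (f + g) = \<phi> f + \<phi> g"
    and mult: "\<And>c f. f \<in> S \<Longrightarrow> \<phi> (fun_scale c f) = fun_scale c (\<phi> f)"
    and surj: "\<And>g. g \<in> T \<Longrightarrow> \<exists>f\<in>S. \<phi> f = g"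
    and fin: "findim {f \<in> S. \<phi> f = 0}" "findim T"
  shows "findim S" "fun_vs.dim S = fun_vs.dim {f \<in> S. \<phi> f = 0} + fun_vs.dim T"
proof -
  obtain B where B: "B \<subseteq> T" "finite B" "fun_vs.independent B" "T \<subseteq> fun_vs.span B" "card B = fun_vs.dim T"
    using findim_basis[OF fin(2)] .
  have sub: "fun_vs.subspace {f \<in> S. \<phi> f \<in> fun_vs.span C}" for C
    using S mult[of 0 0] by (auto simp: fun_vs.subspace_def add mult fun_vs.span_add fun_vs.span_scale fun_vs.span_zero)
  define Z where "Z = {f \<in> S. \<phi> f = 0}"
  have main: "C \<subseteq> T \<Longrightarrow> fun_vs.independent C \<Longrightarrow> findim {f \<in> S. \<phi> f \<in> fun_vs.span C} \<and>
      fun_vs.dim {f \<in> S. \<phi> f \<in> fun_vs.span C} = fun_vs.dim Z + card C" if "finite C" for C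
    using that
  proof (induction C)
    case empty
    then show ?case using fin by (simp add: Z_def)
  next
    case (insert b C)
    let ?S = "\<lambda>C. {f \<in> S. \<phi> f \<in> fun_vs.span C}"
    have IH: "findim (?S C)" "fun_vs.dim (?S C) = fun_vs.dim Z + card C"
      and b: "b \<notin> fun_vs.span C"
      using insert by (auto simp: fun_vs.independent_insert)
    obtain x where x: "x \<in> S" "\<phi> x = b" using surj insert.prems by blast
    have span_S: "fun_vs.span (?S C) = ?S C" by (rule fun_vs.span_eq_iff[THEN iffD2, OF sub])
    have "\<phi> (f - fun_scale k x) = \<phi> f - fun_scale k b" if "f \<in> S" for f k
      using add[of f "fun_scale (- k) x"] mult[OF x(1), of "- k"] that x fun_vs.subspace_scale[OF S x(1), of "- k"] by simp
    moreover have "f - fun_scale k x \<in> S \<longleftrightarrow> f \<in> S" for f k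
      using fun_vs.subspace_add[OF S, of "f - fun_scale k x" "fun_scale k x"]
        fun_vs.subspace_diff[OF S, of f "fun_scale k x"] fun_vs.subspace_scale[OF S x(1)] by auto
    ultimately have "f \<in> fun_vs.span (insert x (?S C)) \<longleftrightarrow> f \<in> ?S (insert b C)" for f
      unfolding fun_vs.span_breakdown_eq span_S by auto
    then have "fun_vs.span (insert x (?S C)) = ?S (insert b C)" by blast
    moreover have "x \<notin> fun_vs.span (?S C)" unfolding span_S using x b by simp
    ultimately show ?case
      using findim_span_insert[OF IH(1), of x] IH(2) insert.hyps by (simp del: fun_vs.dim_span)
  qed
  have "{f \<in> S. \<phi> f \<in> fun_vs.span B} = S" using \<phi>T B(4) by blast
  then show "findim S" "fun_vs.dim S = fun_vs.dim {f \<in> S. \<phi> f = 0} + fun_vs.dim T"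
    using main[OF B(2,1,3)] B(5) unfolding Z_def by simp_all
qed

lemma findim_0: "findim {0 :: 'v \<Rightarrow> complex}"
  unfolding findim_def by (rule exI[of _ "{}"]) simp

lemma dim_0: "fun_vs.dim {0 :: 'v \<Rightarrow> complex} = 0"
  using fun_vs.dim_le_card[of "{0 :: 'v \<Rightarrow> complex}" "{}"] by simp

lemma sum_fun_apply: "(\<Sum>i\<in>I. f i) v = (\<Sum>i\<in>I. f i v)" for f :: "'i \<Rightarrow> 'w \<Rightarrow> complex"
  by (induction I rule: infinite_finite_induct) auto

lemma subspace_mult_preimage:
  assumes "fun_vs.subspace W"
  shows "fun_vs.subspace {f. (\<lambda>v. f v * g v) \<in> W}"
proof (rule fun_vs.subspaceI)
  show "0 \<in> {f. (\<lambda>v. f v * g v) \<in> W}"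
    using fun_vs.subspace_0[OF assms] by (simp add: zero_fun_def)
next
  fix x y assume "x \<in> {f. (\<lambda>v. f v * g v) \<in> W}" "y \<in> {f. (\<lambda>v. f v * g v) \<in> W}"
  then have "(\<lambda>v. x v * g v) + (\<lambda>v. y v * g v) \<in> W" using fun_vs.subspace_add[OF assms] by blast
  then show "x + y \<in> {f. (\<lambda>v. f v * g v) \<in> W}" by (simp add: plus_fun_def distrib_right)
next
  fix c x assume "x \<in> {f. (\<lambda>v. f v * g v) \<in> W}"
  then have "fun_scale c (\<lambda>v. x v * g v) \<in> W" using fun_vs.subspace_scale[OF assms] by blast
  then show "fun_scale c x \<in> {f. (\<lambda>v. f v * g v) \<in> W}" by (simp add: fun_scale_def mult.assoc)
qed

lemma fps_to_fls_sum: "fps_to_fls (\<Sum>i\<in>I. f i) = (\<Sum>i\<in>I. fps_to_fls (f i))"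
  by (induction I rule: infinite_finite_induct) simp_all

lemma proots_mult_le_degree:
  fixes p :: "'a::idom poly"
  assumes "p \<noteq> 0" "finite X" "\<And>c. c \<in> X \<Longrightarrow> \<mu> c \<le> order c p"
  shows "(\<Sum>c\<in>X. \<mu> c) \<le> degree p"
proof -
  have "(\<Sum>c\<in>X. \<mu> c) \<le> (\<Sum>c\<in>X. count (proots p) c)"
    using assms by (intro sum_mono) simp
  also have "\<dots> \<le> (\<Sum>c\<in>X \<union> set_mset (proots p). count (proots p) c)"
    using assms(2) by (intro sum_mono2) auto
  also have "\<dots> = size (proots p)"
    unfolding size_multiset_overloaded_eq using assms(2)
    by (intro sum.mono_neutral_right) (auto simp: not_in_iff simp del: set_count_proots)
  also have "\<dots> \<le> degree p" by (rule size_proots_le)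
  finally show ?thesis .
qed

text \<open>The coefficients of the shifted polynomial are the Taylor coefficients of
  \<open>p\<close> at \<open>c\<close>. If the first \<open>\<mu>\<close> of them vanish, a power of
  the variable splits off, and shifting back turns it into a power of
  \<open>[:- c, 1:]\<close>.\<close>

lemma order_ge_if_shift_coeffs_zero:
  fixes p :: "'a::field_char_0 poly"
  assumes "\<And>b. b < \<mu> \<Longrightarrow> coeff (pcompose p [:c, 1:]) b = 0" "p \<noteq> 0"
  shows "\<mu> \<le> order c p"
proof -
  have "monom 1 \<mu> dvd pcompose p [:c, 1:]"
    using assms(1) by (simp add: monom_1_dvd_iff')
  then obtain r where r: "pcompose p [:c, 1:] = monom 1 \<mu> * r" by (rule dvdE)
  have "p = pcompose (pcompose p [:c, 1:]) [:- c, 1:]"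
    by (simp flip: pcompose_assoc add: pcompose_pCons)
  also have "\<dots> = [:- c, 1:] ^ \<mu> * pcompose r [:- c, 1:]"
    unfolding r poly_eq_poly_eq_iff[symmetric] by (simp add: fun_eq_iff poly_pcompose poly_monom)
  finally show ?thesis using assms(2) order_divides by (metis dvd_triv_left)
qed


subsection \<open>Coefficients along affine lines\<close>

lemma functional_add: "functional scale \<phi> \<Longrightarrow> \<phi> (x + y) = \<phi> x + \<phi> y"
  and functional_scale: "functional scale \<phi> \<Longrightarrow> \<phi> (scale c x) = c * \<phi> x"
  by (auto simp: Vector_Spaces.linear_def dest: module_hom.add module_hom.scale)

lemma poly_eq_sum_atMost:
  fixes p :: "'a::comm_semiring_1 poly"
  assumes "degree p \<le> N"
  shows "poly p x = (\<Sum>i\<le>N. coeff p i * x ^ i)"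
  unfolding poly_altdef using assms
  by (intro sum.mono_neutral_left) (auto simp: coeff_eq_0)

locale complex_space = vector_space scale
  for scale :: "complex \<Rightarrow> 'v::ab_group_add \<Rightarrow> 'v"
begin

abbreviation PF :: "('v \<Rightarrow> complex) set" where
  "PF \<equiv> poly_funs scale"

definition line_poly :: "('v \<Rightarrow> complex) \<Rightarrow> 'v \<Rightarrow> 'v \<Rightarrow> complex poly" where
  "line_poly f h a = (THE p. \<forall>t. f (a + scale t h) = poly p t)"

text \<open>On polynomial functions this is the divided directional derivative: the
  \<open>i\<close>-th derivative along \<open>h\<close>, divided by the factorial of
  \<open>i\<close>.\<close>

definition dcoeff :: "'v \<Rightarrow> nat \<Rightarrow> ('v \<Rightarrow> complex) \<Rightarrow> 'v \<Rightarrow> complex" where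
  "dcoeff h i f = (\<lambda>a. coeff (line_poly f h a) i)"

lemma line_poly_eqI:
  assumes "\<And>t. f (a + scale t h) = poly p t"
  shows "line_poly f h a = p"
  unfolding line_poly_def
  by (rule the_equality) (use assms in \<open>auto simp flip: poly_eq_poly_eq_iff\<close>)

lemma poly_line_poly:
  assumes "f \<in> PF"
  shows "poly (line_poly f h a) t = f (a + scale t h)"
proof -
  have "\<exists>p. \<forall>t. f (a + scale t h) = poly p t"
    using assms
  proof induction
    case (const c)
    show ?case by (rule exI[of _ "[:c:]"]) simp
  next
    case (functional \<phi>)
    show ?case
      by (rule exI[of _ "[:\<phi> a, \<phi> h:]"])
        (simp add: functional_add[OF functional] functional_scale[OF functional])
  next
    case (add f g)
    then show ?case by (metis poly_add)
  next
    case (mult f g)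
    then show ?case by (metis poly_mult)
  qed
  then show ?thesis using line_poly_eqI by metis
qed

lemma line_poly_const: "line_poly (\<lambda>_. c) h a = [:c:]"
  by (rule line_poly_eqI) simp

lemma dcoeff_0: "dcoeff h i (\<lambda>_. 0) a = 0"
  by (simp add: dcoeff_def line_poly_const)

lemma line_poly_functional: "functional scale \<phi> \<Longrightarrow> line_poly \<phi> h a = [:\<phi> a, \<phi> h:]"
  by (rule line_poly_eqI) (simp add: functional_add functional_scale)

lemma line_poly_add:
  "f \<in> PF \<Longrightarrow> g \<in> PF \<Longrightarrow> line_poly (\<lambda>v. f v + g v) h a = line_poly f h a + line_poly g h a"
  by (rule line_poly_eqI) (simp add: poly_line_poly)

lemma line_poly_mult:
  "f \<in> PF \<Longrightarrow> g \<in> PF \<Longrightarrow> line_poly (\<lambda>v. f v * g v) h a = line_poly f h a * line_poly g h a"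
  by (rule line_poly_eqI) (simp add: poly_line_poly)

lemma line_poly_cmult: "f \<in> PF \<Longrightarrow> line_poly (\<lambda>v. c * f v) h a = smult c (line_poly f h a)"
  by (rule line_poly_eqI) (simp add: poly_line_poly)

lemma PF_sum: "finite I \<Longrightarrow> (\<And>i. i \<in> I \<Longrightarrow> f i \<in> PF) \<Longrightarrow> (\<lambda>v. \<Sum>i\<in>I. f i v) \<in> PF"
  by (induction I rule: finite_induct) (auto intro: poly_funs.intros)

lemma PF_prod: "finite I \<Longrightarrow> (\<And>i. i \<in> I \<Longrightarrow> f i \<in> PF) \<Longrightarrow> (\<lambda>v. \<Prod>i\<in>I. f i v) \<in> PF"
  by (induction I rule: finite_induct) (auto intro: poly_funs.intros)

lemma line_poly_prod:
  assumes "finite I" "\<And>i. i \<in> I \<Longrightarrow> f i \<in> PF"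
  shows "line_poly (\<lambda>v. \<Prod>i\<in>I. f i v) h a = (\<Prod>i\<in>I. line_poly (f i) h a)"
  by (rule line_poly_eqI) (simp add: assms poly_line_poly poly_prod)

lemma PF_cmult: "f \<in> PF \<Longrightarrow> (\<lambda>v. c * f v) \<in> PF"
  by (rule poly_funs.mult[OF poly_funs.const])

lemma subspace_PF: "fun_vs.subspace PF"
  using poly_funs.const[of 0 scale]
  by (auto simp: fun_vs.subspace_def fun_scale_def zero_fun_def plus_fun_def intro: poly_funs.add PF_cmult)

text \<open>Uniformity in \<open>a\<close> allows expansions along parallel lines to be cut off at
  one common index.\<close>

lemma degree_line_poly_bounded:
  assumes "f \<in> PF"
  shows "\<exists>N. \<forall>a. degree (line_poly f h a) \<le> N"
  using assms
proof induction
  case (const c)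
  show ?case by (simp add: line_poly_const)
next
  case (functional \<phi>)
  show ?case by (rule exI[of _ 1]) (simp add: line_poly_functional[OF functional])
next
  case (add f g)
  then obtain M N where "\<forall>a. degree (line_poly f h a) \<le> M" "\<forall>a. degree (line_poly g h a) \<le> N"
    by blast
  then have "\<forall>a. degree (line_poly (\<lambda>v. f v + g v) h a) \<le> max M N"
    unfolding line_poly_add[OF add.hyps] by (blast intro: degree_add_le max.coboundedI1 max.coboundedI2)
  then show ?case by blast
next
  case (mult f g)
  then obtain M N where "\<forall>a. degree (line_poly f h a) \<le> M" "\<forall>a. degree (line_poly g h a) \<le> N"
    by blast
  then have "\<forall>a. degree (line_poly (\<lambda>v. f v * g v) h a) \<le> M + N"
    unfolding line_poly_mult[OF mult.hyps] by (auto intro!: order_trans[OF degree_mult_le] add_mono)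
  then show ?case by blast
qed

lemma dcoeff_PF: "f \<in> PF \<Longrightarrow> dcoeff h i f \<in> PF"
proof (induction arbitrary: i rule: poly_funs.induct)
  case (const c)
  show ?case by (simp add: dcoeff_def line_poly_const poly_funs.const)
next
  case (functional \<phi>)
  show ?case
    by (cases i)
      (auto simp: dcoeff_def line_poly_functional[OF functional] coeff_pCons
        intro: poly_funs.const poly_funs.functional[OF functional] split: nat.splits)
next
  case (add f g)
  then show ?case by (auto simp: dcoeff_def line_poly_add intro: poly_funs.add)
next
  case (mult f g)
  then show ?case
    by (auto simp: dcoeff_def line_poly_mult coeff_mult intro!: PF_sum poly_funs.mult)
qed

text \<open>A binomial theorem for divided derivatives. Expand \<open>f\<close> along
  \<open>k\<close>, then every coefficient along \<open>h\<close>, and compare the coefficients of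
  \<open>s ^ D\<close>.\<close>

lemma dcoeff_linear_combination:
  assumes "f \<in> PF"
  shows "dcoeff (scale x k + scale y h) D f a =
    (\<Sum>w\<le>D. x ^ w * y ^ (D - w) * dcoeff h (D - w) (dcoeff k w f) a)"
proof -
  obtain N0 where "\<forall>b. degree (line_poly f k b) \<le> N0"
    using degree_line_poly_bounded[OF assms] by blast
  then obtain N where N: "N \<ge> D" "\<And>b. degree (line_poly f k b) \<le> N"
    by (metis max.cobounded1 max.coboundedI2)
  have "\<forall>w. \<exists>M. \<forall>b. degree (line_poly (dcoeff k w f) h b) \<le> M"
    using degree_line_poly_bounded dcoeff_PF assms by blast
  then obtain M0 where M0: "\<And>w b. degree (line_poly (dcoeff k w f) h b) \<le> M0 w"
    by metis
  \<comment> \<open>One cut-off for all \<open>w \<le> N\<close>; it is at least \<open>D\<close> so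
    that the index \<open>D - w\<close> stays in range.\<close>
  define M where "M = D + (\<Sum>w\<le>N. M0 w)"
  have M: "M \<ge> D" "\<And>w b. w \<le> N \<Longrightarrow> degree (line_poly (dcoeff k w f) h b) \<le> M"
  proof -
    fix w b assume "w \<le> N"
    then have "M0 w \<le> (\<Sum>w\<le>N. M0 w)" by (intro member_le_sum) auto
    then show "degree (line_poly (dcoeff k w f) h b) \<le> M"
      using M0[of w b] unfolding M_def by linarith
  qed (simp add: M_def)
  define P where "P = (\<Sum>w\<le>N. \<Sum>i\<le>M. monom (x ^ w * y ^ i * dcoeff h i (dcoeff k w f) a) (w + i))"
  have "f (a + scale s (scale x k + scale y h)) = poly P s" for s
  proof -
    have "a + scale s (scale x k + scale y h) = (a + scale (s * y) h) + scale (s * x) k"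
      by (simp add: scale_right_distrib)
    then have "f (a + scale s (scale x k + scale y h)) = poly (line_poly f k (a + scale (s * y) h)) (s * x)"
      by (simp only: poly_line_poly[OF assms])
    also have "\<dots> = (\<Sum>w\<le>N. dcoeff k w f (a + scale (s * y) h) * (s * x) ^ w)"
      by (simp add: poly_eq_sum_atMost[OF N(2)] dcoeff_def)
    also have "\<dots> = (\<Sum>w\<le>N. poly (line_poly (dcoeff k w f) h a) (s * y) * (s * x) ^ w)"
      using assms by (simp add: poly_line_poly dcoeff_PF)
    also have "\<dots> = (\<Sum>w\<le>N. (\<Sum>i\<le>M. dcoeff h i (dcoeff k w f) a * (s * y) ^ i) * (s * x) ^ w)"
      by (intro sum.cong refl arg_cong2[where f = "(*)"] poly_eq_sum_atMost[OF M(2), THEN trans]) (simp_all add: dcoeff_def[of h])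
    also have "\<dots> = poly P s"
      by (simp add: P_def poly_sum poly_monom sum_distrib_left sum_distrib_right power_mult_distrib
          power_add mult_ac)
    finally show ?thesis .
  qed
  then have "dcoeff (scale x k + scale y h) D f a = coeff P D"
    by (simp add: dcoeff_def line_poly_eqI)
  also have "\<dots> = (\<Sum>w\<le>N. \<Sum>i\<le>M. if i = D - w \<and> w \<le> D
      then x ^ w * y ^ i * dcoeff h i (dcoeff k w f) a else 0)"
    unfolding P_def by (auto simp: coeff_sum intro!: sum.cong)
  also have "\<dots> = (\<Sum>w\<le>N. if w \<le> D then x ^ w * y ^ (D - w) * dcoeff h (D - w) (dcoeff k w f) a else 0)"
    using M(1) by (intro sum.cong refl) auto
  also have "\<dots> = (\<Sum>w\<le>D. x ^ w * y ^ (D - w) * dcoeff h (D - w) (dcoeff k w f) a)"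
    using N(1) by (intro sum.mono_neutral_cong_right) auto
  finally show ?thesis .
qed

text \<open>The same coefficient, expanded in both orders. With \<open>h\<close> innermost, the
  bound on \<open>f\<close> along \<open>h\<close> limits the degree in \<open>u\<close>; with
  \<open>k\<close> innermost, the bound along \<open>k\<close> kills the low powers of
  \<open>u\<close>.\<close>

lemma dcoeff_direction_shift:
  assumes "f \<in> PF"
  shows "dcoeff (k + scale u h) D f a = (\<Sum>w\<le>D. u ^ (D - w) * dcoeff h (D - w) (dcoeff k w f) a)"
    and "dcoeff (k + scale u h) D f a = (\<Sum>i\<le>D. u ^ i * dcoeff k (D - i) (dcoeff h i f) a)"
proof -
  show "dcoeff (k + scale u h) D f a = (\<Sum>w\<le>D. u ^ (D - w) * dcoeff h (D - w) (dcoeff k w f) a)"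
    using dcoeff_linear_combination[OF assms, of 1 k u h D a] by simp
  show "dcoeff (k + scale u h) D f a = (\<Sum>i\<le>D. u ^ i * dcoeff k (D - i) (dcoeff h i f) a)"
    using dcoeff_linear_combination[OF assms, of u h 1 k D a] by (simp add: add.commute[of k])
qed

section \<open>Degree bounds along a direction\<close>

definition deg_less :: "'v \<Rightarrow> nat \<Rightarrow> ('v \<Rightarrow> complex) \<Rightarrow> bool" where
  "deg_less h m f \<longleftrightarrow> (\<forall>i\<ge>m. \<forall>a. dcoeff h i f a = 0)"

lemma deg_less_mono: "deg_less h m f \<Longrightarrow> m \<le> m' \<Longrightarrow> deg_less h m' f"
  by (auto simp: deg_less_def)

lemma deg_less_0: "f \<in> PF \<Longrightarrow> deg_less h 0 f \<Longrightarrow> f v = 0"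
proof -
  assume f: "f \<in> PF" "deg_less h 0 f"
  have "line_poly f h v = 0"
    using f(2) by (intro poly_eqI) (simp add: deg_less_def dcoeff_def)
  then show "f v = 0" using poly_line_poly[OF f(1), of h v 0] by simp
qed

text \<open>The bridge to the condition in \<open>C_space\<close>: the witness polynomial can only
  be \<open>line_poly f h a\<close>.\<close>

lemma deg_less_iff_ex:
  assumes "f \<in> PF"
  shows "deg_less h m f \<longleftrightarrow>
    (\<forall>a. \<exists>p. (\<forall>t. f (a + scale t h) = poly p t) \<and> (p = 0 \<or> degree p < m))"
proof -
  have 1: "(\<exists>p. (\<forall>t. f (a + scale t h) = poly p t) \<and> (p = 0 \<or> degree p < m)) \<longleftrightarrow>
      (line_poly f h a = 0 \<or> degree (line_poly f h a) < m)" for a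
    using line_poly_eqI poly_line_poly[OF assms] by metis
  have 2: "(p = 0 \<or> degree p < m) \<longleftrightarrow> (\<forall>i\<ge>m. coeff p i = 0)" for p :: "complex poly"
    by (metis coeff_0 coeff_eq_0 leading_coeff_0_iff not_le order.strict_trans2)
  show ?thesis unfolding deg_less_def dcoeff_def 1 unfolding 2 by blast
qed

lemma deg_less_Suc_0_iff:
  assumes "f \<in> PF"
  shows "deg_less h (Suc 0) f \<longleftrightarrow> (\<forall>a t. f (a + scale t h) = f a)"
proof
  assume "deg_less h (Suc 0) f"
  then have "degree (line_poly f h a) = 0" for a
    by (metis Suc_le_eq deg_less_def dcoeff_def leading_coeff_0_iff degree_0 gr0I)
  then have "poly (line_poly f h a) t = poly (line_poly f h a) 0" for a t
    by (metis degree_eq_zeroE poly_pCons mult_zero_right poly_0 add.right_neutral)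
  then show "\<forall>a t. f (a + scale t h) = f a" by (simp add: poly_line_poly[OF assms])
next
  assume "\<forall>a t. f (a + scale t h) = f a"
  then have "line_poly f h a = [:f a:]" for a by (intro line_poly_eqI) simp
  then show "deg_less h (Suc 0) f"
    by (auto simp: deg_less_def dcoeff_def coeff_pCons split: nat.splits)
qed

text \<open>One factor has degree at most \<open>x\<close>, the other degree less than
  \<open>b\<close>. The asymmetry makes the bound sharp and covers \<open>b = 0\<close>, where the
  product vanishes.\<close>

lemma deg_less_mult:
  assumes "f \<in> PF" "g \<in> PF" "deg_less h (Suc x) f" "deg_less h b g"
  shows "deg_less h (x + b) (\<lambda>v. f v * g v)"
  unfolding deg_less_def
proof (intro allI impI)
  fix i a assume i: "x + b \<le> i"
  have "coeff (line_poly f h a) j * coeff (line_poly g h a) (i - j) = 0" for j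
    using assms(3,4) i unfolding deg_less_def dcoeff_def
    by (cases "j \<le> x") auto
  then show "dcoeff h i (\<lambda>v. f v * g v) a = 0"
    unfolding dcoeff_def line_poly_mult[OF assms(1,2)] coeff_mult by (rule sum.neutral[OF ballI])
qed

lemma deg_less_add: 
  "f \<in> PF \<Longrightarrow> g \<in> PF \<Longrightarrow> deg_less h b f \<Longrightarrow> deg_less h b g \<Longrightarrow> deg_less h b (\<lambda>v. f v + g v)"
  by (simp add: deg_less_def dcoeff_def line_poly_add)

lemma deg_less_cmult: 
  "f \<in> PF \<Longrightarrow> deg_less h b f \<Longrightarrow> deg_less h b (\<lambda>v. c * f v)"
  by (simp add: deg_less_def dcoeff_def line_poly_cmult)

lemma deg_less_prod_functionals:
  assumes "finite I" "\<And>i. i \<in> I \<Longrightarrow> functional scale (l i)"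
  shows "deg_less h (Suc (card {i \<in> I. l i h \<noteq> 0})) (\<lambda>v. \<Prod>i\<in>I. l i v)"
  using assms
proof (induction I rule: finite_induct)
  case empty
  show ?case by (simp add: deg_less_Suc_0_iff poly_funs.const)
next
  case (insert j I)
  let ?b = "\<lambda>I. Suc (card {i \<in> I. l i h \<noteq> 0})"
  define x where "x = (if l j h = 0 then 0 else 1 :: nat)"
  have "deg_less h (Suc x) (l j)"
    using insert.prems
    by (auto simp: deg_less_def dcoeff_def line_poly_functional coeff_pCons x_def split: nat.splits)
  then have "deg_less h (x + ?b I) (\<lambda>v. l j v * (\<Prod>i\<in>I. l i v))"
    using insert by (intro deg_less_mult) (auto intro: poly_funs.functional PF_prod)
  moreover have "{i \<in> insert j I. l i h \<noteq> 0} = (if l j h = 0 then {} else {j}) \<union> {i \<in> I. l i h \<noteq> 0}"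
    by auto
  then have "x + ?b I = ?b (insert j I)"
    using insert.hyps by (auto simp: x_def)
  ultimately show ?case using insert.hyps by simp
qed

section \<open>Homogeneous polynomials\<close>

text \<open>For fixed \<open>v\<close> both sides are polynomials in \<open>c\<close>, so
  coefficients may be compared. The left side expresses homogeneity of degree \<open>d - e\<close>
  without subtraction and forces \<open>g = 0\<close> when \<open>e\<close> exceeds
  \<open>d\<close>.\<close>

lemma scaled_hom_iff:
  assumes "g \<in> PF"
  shows "(\<forall>c v. c ^ e * g (scale c v) = c ^ d * g v) \<longleftrightarrow>
    (if e \<le> d then \<forall>c v. g (scale c v) = c ^ (d - e) * g v else \<forall>v. g v = 0)" (is "?L \<longleftrightarrow> ?R")
proof
  assume L: ?L
  define P where "P v = line_poly g v 0" for v
  have P: "poly (P v) c = g (scale c v)" for c v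
    using poly_line_poly[OF assms, of v 0 c] by (simp add: P_def)
  have eq: "monom 1 e * P v = monom (g v) d" for v
    unfolding poly_eq_poly_eq_iff[symmetric] using L by (auto simp: fun_eq_iff poly_monom P)
  have c: "coeff (monom 1 e * P v) i = coeff (monom (g v) d) i" for i v by (simp add: eq)
  show ?R
  proof (cases "e \<le> d")
    case True
    have "P v = monom (g v) (d - e)" for v
      using c[of v "e + _"] True by (intro poly_eqI) (auto simp: coeff_monom_mult)
    then have "g (scale c v) = c ^ (d - e) * g v" for c v
      by (metis P poly_monom mult.commute)
    then show ?thesis using True by simp
  next
    case False
    then show ?thesis using c[of _ d] by (auto simp: coeff_monom_mult)
  qed
next
  assume ?R
  then show ?L
    by (auto split: if_splits simp flip: power_add mult.assoc)
qed

lemma dcoeff_hom: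
  assumes "f \<in> PF" "\<And>c v. f (scale c v) = c ^ d * f v"
  shows "c ^ i * dcoeff h i f (scale c v) = c ^ d * dcoeff h i f v"
proof -
  have "pcompose (line_poly f h (scale c v)) [:0, c:] = smult (c ^ d) (line_poly f h v)"
    unfolding poly_eq_poly_eq_iff[symmetric]
  proof
    fix t
    have "scale c v + scale (c * t) h = scale c (v + scale t h)"
      by (simp add: scale_right_distrib)
    then show "poly (pcompose (line_poly f h (scale c v)) [:0, c:]) t = poly (smult (c ^ d) (line_poly f h v)) t"
      using assms by (simp add: poly_pcompose poly_line_poly mult.commute)
  qed
  then have "coeff (pcompose (line_poly f h (scale c v)) [:0, c:]) i = c ^ d * dcoeff h i f v"
    by (simp add: dcoeff_def)
  then show ?thesis by (simp add: coeff_pcompose_linear dcoeff_def)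
qed

text \<open>Products of \<open>d\<close> functionals clearly scale by \<open>c ^ d\<close>.
  Conversely, the component of degree \<open>d\<close> of any polynomial function lies in their
  span, and a function that scales by \<open>c ^ d\<close> is its own component.\<close>

lemma hom_poly_funs_eq:
  "hom_poly_funs scale d = {f \<in> PF. \<forall>c v. f (scale c v) = c ^ d * f v}"
proof -
  define G where "G d = {(\<lambda>v. \<Prod>j<d. \<phi> j v) | \<phi>. \<forall>j<d. functional scale (\<phi> j)}" for d :: nat
  have span_G: "hom_poly_funs scale d = fun_vs.span (G d)" for d
    by (simp add: hom_poly_funs_def G_def)
  let ?H = "{f \<in> PF. \<forall>c v. f (scale c v) = c ^ d * f v}"
  have sub: "fun_vs.subspace (hom_poly_funs scale d)" for d
    by (simp add: span_G)
  \<comment> \<open>Generators multiply by concatenating their lists of factors; spanning in one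
    argument and then in the other extends this to all elements.\<close>
  have hmult: "(\<lambda>v. f v * g v) \<in> hom_poly_funs scale (d + e)"
    if "f \<in> hom_poly_funs scale d" "g \<in> hom_poly_funs scale e" for f g d e
  proof -
    have mG: "(\<lambda>v. f v * g v) \<in> hom_poly_funs scale (d + e)" if f: "f \<in> G d" and g: "g \<in> G e" for f g
    proof -
      obtain \<phi> \<psi> where \<phi>: "f = (\<lambda>v. \<Prod>j<d. \<phi> j v)" "\<forall>j<d. functional scale (\<phi> j)"
        and \<psi>: "g = (\<lambda>v. \<Prod>j<e. \<psi> j v)" "\<forall>j<e. functional scale (\<psi> j)"
        using f g by (auto simp: G_def)
      define \<chi> where "\<chi> j = (if j < d then \<phi> j else \<psi> (j - d))" for j
      have "f v * g v = (\<Prod>j<d + e. \<chi> j v)" for v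
      proof -
        have "{..<d + e} = {..<d} \<union> {d..<d + e}" by auto
        then have "(\<Prod>j<d + e. \<chi> j v) = (\<Prod>j<d. \<chi> j v) * (\<Prod>j=d..<d + e. \<chi> j v)"
          by (simp add: prod.union_disjoint ivl_disj_int)
        also have "(\<Prod>j=d..<d + e. \<chi> j v) = (\<Prod>j<e. \<chi> (j + d) v)"
          using prod.shift_bounds_nat_ivl[of "\<lambda>j. \<chi> j v" 0 d e] by (simp add: lessThan_atLeast0 add.commute)
        finally show ?thesis by (simp add: \<phi> \<psi> \<chi>_def)
      qed
      moreover have "\<forall>j<d + e. functional scale (\<chi> j)" using \<phi> \<psi> by (auto simp: \<chi>_def)
      ultimately have "(\<lambda>v. f v * g v) \<in> G (d + e)" unfolding G_def by auto
      then show ?thesis unfolding span_G by (rule fun_vs.span_base)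
    qed
    have "hom_poly_funs scale d \<subseteq> {f. (\<lambda>v. f v * g v) \<in> hom_poly_funs scale (d + e)}" if "g \<in> G e" for g
      unfolding span_G[of d] by (rule fun_vs.span_minimal) (use mG that subspace_mult_preimage[OF sub] in auto)
    then have "G e \<subseteq> {g. (\<lambda>v. g v * f v) \<in> hom_poly_funs scale (d + e)}"
      using that(1) by (auto simp: mult.commute)
    then have "hom_poly_funs scale e \<subseteq> {g. (\<lambda>v. g v * f v) \<in> hom_poly_funs scale (d + e)}"
      unfolding span_G[of e] by (rule fun_vs.span_minimal) (rule subspace_mult_preimage[OF sub])
    then show ?thesis using that(2) by (auto simp: mult.commute)
  qed
  \<comment> \<open>The component is the coefficient of \<open>t ^ d\<close> in
    \<open>f (scale t v)\<close>, that is, along the line through 0 in direction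
    \<open>v\<close>.\<close>
  have component: "(\<lambda>v. dcoeff v d f 0) \<in> hom_poly_funs scale d" if "f \<in> PF" for f d
    using that
  proof (induction arbitrary: d)
    case (const c)
    show ?case
    proof (cases "d = 0")
      case True
      have "fun_scale c (\<lambda>v. 1) \<in> hom_poly_funs scale 0"
        unfolding span_G by (intro fun_vs.span_scale fun_vs.span_base) (auto simp: G_def)
      then show ?thesis using True by (simp add: dcoeff_def line_poly_const fun_scale_def)
    next
      case False
      then show ?thesis using fun_vs.subspace_0[OF sub]
        by (simp add: dcoeff_def line_poly_const coeff_pCons zero_fun_def split: nat.splits)
    qed
  next
    case (functional \<phi>)
    have "\<phi> \<in> hom_poly_funs scale 1"
      unfolding span_G G_def using functional
      by (intro fun_vs.span_base CollectI exI[of _ "\<lambda>_. \<phi>"]) auto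
    moreover have "\<phi> 0 = 0" using functional_scale[OF functional, of 0 0] by simp
    then have "(\<lambda>v. dcoeff v d \<phi> 0) = (if d = 1 then \<phi> else 0)"
      by (auto simp: fun_eq_iff dcoeff_def line_poly_functional[OF functional] coeff_pCons split: nat.splits)
    ultimately show ?case using fun_vs.subspace_0[OF sub] by simp
  next
    case (add f g)
    then show ?case
      using fun_vs.subspace_add[OF sub add.IH(1)[of d] add.IH(2)[of d]]
      by (simp add: dcoeff_def line_poly_add plus_fun_def)
  next
    case (mult f g)
    have "(\<Sum>j\<le>d. (\<lambda>v. dcoeff v j f 0 * dcoeff v (d - j) g 0)) \<in> hom_poly_funs scale d"
      using hmult[OF mult.IH] by (intro fun_vs.subspace_sum sub) (metis atMost_iff le_add_diff_inverse)
    moreover have "(\<Sum>j\<le>d. (\<lambda>v. dcoeff v j f 0 * dcoeff v (d - j) g 0)) =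
        (\<lambda>v. dcoeff v d (\<lambda>v. f v * g v) 0)"
      by (simp add: fun_eq_iff dcoeff_def line_poly_mult mult.hyps coeff_mult sum_fun_apply)
    ultimately show ?case by simp
  qed
  show ?thesis
  proof
    have "G d \<subseteq> ?H"
      by (auto intro!: PF_prod intro: poly_funs.functional simp: G_def functional_scale prod.distrib)
    moreover have "fun_vs.subspace ?H"
      using subspace_PF
      by (auto simp: fun_vs.subspace_def fun_scale_def zero_fun_def plus_fun_def algebra_simps)
    ultimately show "hom_poly_funs scale d \<subseteq> ?H"
      unfolding span_G by (rule fun_vs.span_minimal)
    show "?H \<subseteq> hom_poly_funs scale d"
    proof
      fix f assume f: "f \<in> ?H"
      have "line_poly f v 0 = monom (f v) d" for v
        by (rule line_poly_eqI) (use f in \<open>simp add: poly_monom\<close>)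
      then have "(\<lambda>v. dcoeff v d f 0) = f" by (simp add: dcoeff_def fun_eq_iff)
      then show "f \<in> hom_poly_funs scale d" using component[of f d] f by simp
    qed
  qed
qed

end


subsection \<open>The spaces interpolating between the central and the internal case\<close>

locale functional_family = complex_space scale
  for scale :: "complex \<Rightarrow> 'v::ab_group_add \<Rightarrow> 'v" +
  fixes l :: "nat \<Rightarrow> 'v \<Rightarrow> complex"
  assumes functional_l: "functional scale (l i)"
begin

definition kern :: "nat set \<Rightarrow> 'v set" where
  "kern A = {v. \<forall>i\<in>A. l i v = 0}"

definition rho :: "nat set \<Rightarrow> 'v \<Rightarrow> nat" where
  "rho A h = card {i \<in> A. l i h \<noteq> 0}"

text \<open>
  Strict degree bounds avoid negative numbers: \<open>deg_less h 0 f\<close> means \<open>f = 0\<close>. Instead of passing to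
  quotients of \<open>V\<close>, a sub-arrangement \<open>A\<close> lives on all of \<open>V\<close>, and the bound 1 along its common
  kernel makes the polynomials of \<open>D A E\<close> constant on the cosets of that kernel.
\<close>

definition dbound :: "nat set \<Rightarrow> nat set \<Rightarrow> 'v \<Rightarrow> nat" where
  "dbound A E h = (if h \<in> kern A then 1 else rho A h - (if \<exists>i\<in>E. l i h \<noteq> 0 then 1 else 0))"

definition D :: "nat set \<Rightarrow> nat set \<Rightarrow> ('v \<Rightarrow> complex) set" where
  "D A E = {f \<in> PF. \<forall>h. deg_less h (dbound A E h) f}"

definition homD :: "nat set \<Rightarrow> nat set \<Rightarrow> nat \<Rightarrow> ('v \<Rightarrow> complex) set" where
  "homD A E d = {f \<in> D A E. \<forall>c v. f (scale c v) = c ^ d * f v}"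

definition loc :: "nat set \<Rightarrow> 'v \<Rightarrow> nat set" where
  "loc A h = {i \<in> A. l i h = 0}"

text \<open>In the quotient by the common kernel of \<open>A\<close>, \<open>h\<close> spans the common kernel of \<open>loc A h\<close>.\<close>

definition is_ray :: "nat set \<Rightarrow> 'v \<Rightarrow> bool" where
  "is_ray A h \<longleftrightarrow> h \<notin> kern A \<and> (\<forall>x\<in>kern (loc A h). \<exists>c. x + scale c h \<in> kern A)"

lemma l_add: "l i (x + y) = l i x + l i y"
  by (rule functional_add[OF functional_l])

lemma l_scale: "l i (scale c x) = c * l i x"
  by (rule functional_scale[OF functional_l])

lemma l_0: "l i 0 = 0"
  using l_scale[of i 0 0] by simp

lemma l_PF: "l i \<in> PF"
  by (rule poly_funs.functional[OF functional_l])

lemma kern_mono: "A \<subseteq> B \<Longrightarrow> kern B \<subseteq> kern A"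
  by (auto simp: kern_def)

lemma kern_insert: "kern (insert e A) = {v \<in> kern A. l e v = 0}"
  by (auto simp: kern_def)

lemma kern_add: "x \<in> kern A \<Longrightarrow> y \<in> kern A \<Longrightarrow> x + y \<in> kern A"
  by (simp add: kern_def l_add)

lemma kern_scale: "x \<in> kern A \<Longrightarrow> scale c x \<in> kern A"
  by (simp add: kern_def l_scale)

lemma rho_loc: "finite A \<Longrightarrow> rho A h = card (A - loc A h)"
  by (auto simp: rho_def loc_def intro: arg_cong[where f = card])

lemma rho_pos: "finite A \<Longrightarrow> i \<in> A \<Longrightarrow> l i h \<noteq> 0 \<Longrightarrow> rho A h > 0"
  by (auto simp: rho_def card_gt_0_iff)

lemma rho_eq_0: "h \<in> kern A \<Longrightarrow> rho A h = 0"
  by (auto simp: rho_def kern_def card_eq_0_iff)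

lemma subspace_D: "fun_vs.subspace (D A E)"
  using fun_vs.subspace_0[OF subspace_PF]
  by (auto simp: D_def fun_vs.subspace_def zero_fun_def plus_fun_def fun_scale_def
      intro: poly_funs.add PF_cmult deg_less_add deg_less_cmult)
    (simp add: deg_less_def dcoeff_0)

lemma D_PF: "f \<in> D A E \<Longrightarrow> f \<in> PF"
  by (simp add: D_def)

lemma D_kern_invariant:
  assumes "f \<in> D A E" "k \<in> kern A"
  shows "f (v + k) = f v"
proof -
  have "deg_less k (Suc 0) f" using assms by (auto simp: D_def dbound_def split: if_splits)
  then have "f (v + scale 1 k) = f v"
    using deg_less_Suc_0_iff[OF D_PF[OF assms(1)]] by blast
  then show ?thesis by simp
qed

section \<open>The top coefficient along a direction\<close>

text \<open>On \<open>loc A h\<close> the functionals do not see the summand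
  \<open>scale c h\<close>; off it, all count except those vanishing at
  \<open>k + scale c h\<close>. The additive form avoids truncated subtraction.\<close>

lemma rho_split:
  assumes "finite A"
  shows "rho A (k + scale c h) + card {i \<in> A - loc A h. l i (k + scale c h) = 0} =
    rho (loc A h) k + rho A h"
proof -
  have "{i \<in> A. l i (k + scale c h) \<noteq> 0} =
      {i \<in> loc A h. l i k \<noteq> 0} \<union> {i \<in> A - loc A h. l i (k + scale c h) \<noteq> 0}"
    by (auto simp: loc_def l_add l_scale)
  moreover have "card ({i \<in> loc A h. l i k \<noteq> 0} \<union> {i \<in> A - loc A h. l i (k + scale c h) \<noteq> 0}) =
      rho (loc A h) k + card {i \<in> A - loc A h. l i (k + scale c h) \<noteq> 0}"
    unfolding rho_def using assms by (intro card_Un_disjoint) (auto simp: loc_def)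
  moreover have "card {i \<in> A - loc A h. l i (k + scale c h) \<noteq> 0} +
      card {i \<in> A - loc A h. l i (k + scale c h) = 0} = card (A - loc A h)"
    using assms by (subst card_Un_disjoint[symmetric]) (auto intro!: arg_cong[where f = card])
  ultimately show ?thesis using rho_loc[OF assms, of h] unfolding rho_def[of A "k + scale c h"] by simp
qed

text \<open>
  Put \<open>m = \<rho>\<^sub>A(h)\<close>. For fixed \<open>a\<close> and \<open>N \<ge> m - 1\<close>, the coefficient of \<open>s\<close> to the power \<open>N\<close> in \<open>f(a + s (k + t h))\<close> is a
  polynomial \<open>Q(t)\<close> of degree less than \<open>m\<close>. If \<open>N\<close> is large, the degree bound along \<open>k + c h\<close> makes \<open>Q\<close> vanish at \<open>c\<close>
  to the order of the number of \<open>i\<close> with \<open>l i h \<noteq> 0 = l i (k + c h)\<close>. These orders add up to \<open>m\<close>, so \<open>Q = 0\<close>.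
\<close>

lemma residue_deg_less:
  assumes A: "finite A" "E \<subseteq> A" and f: "f \<in> D A E"
    and h: "h \<notin> kern A" "\<And>i. i \<in> E \<Longrightarrow> l i h = 0"
    and k: "\<And>c. k + scale c h \<notin> kern A"
  shows "deg_less k (rho (loc A h) k - (if \<exists>i\<in>E. l i k \<noteq> 0 then 1 else 0))
    (dcoeff h (rho A h - 1) f)"
  unfolding deg_less_def
proof (intro allI impI)
  define m where "m = rho A h"
  define \<epsilon> where "\<epsilon> = (if \<exists>i\<in>E. l i k \<noteq> 0 then 1 else 0 :: nat)"
  define J where "J = A - loc A h"
  define \<mu> where "\<mu> c = card {i \<in> J. l i (k + scale c h) = 0}" for c
  fix j a
  assume "rho (loc A h) k - (if \<exists>i\<in>E. l i k \<noteq> 0 then 1 else 0) \<le> j"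
  then have j: "rho (loc A h) k - \<epsilon> \<le> j" unfolding \<epsilon>_def by simp
  have fin: "finite J" "finite (loc A h)" using A by (auto simp: J_def loc_def)
  have cardJ: "card J = m" using rho_loc[OF A(1)] by (simp add: m_def J_def)
  have mpos: "m > 0" using h(1) A rho_pos unfolding m_def kern_def by blast
  have EF: "E \<subseteq> loc A h" using A h by (auto simp: loc_def)
  have \<epsilon>le: "\<epsilon> \<le> rho (loc A h) k"
    using rho_pos[OF fin(2)] EF by (fastforce simp: \<epsilon>_def Suc_le_eq)
  have PF: "f \<in> PF" using D_PF f .
  have seesE: "(\<exists>i\<in>E. l i (k + scale c h) \<noteq> 0) \<longleftrightarrow> (\<exists>i\<in>E. l i k \<noteq> 0)" for c
    using h(2) by (simp add: l_add l_scale)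
  have bound: "dbound A E (k + scale c h) = rho (loc A h) k + m - \<mu> c - \<epsilon>" for c
  proof -
    have "dbound A E (k + scale c h) = rho A (k + scale c h) - \<epsilon>"
      unfolding dbound_def \<epsilon>_def seesE using k by simp
    then show ?thesis using rho_split[OF A(1), of k c h] unfolding \<mu>_def J_def m_def by simp
  qed
  have van: "dcoeff (k + scale c h) w f b = 0" if "w \<ge> rho (loc A h) k + m - \<mu> c - \<epsilon>" for c w b
    using f that unfolding D_def deg_less_def bound[symmetric] by blast
  have "dbound A E h = m" using h by (auto simp: dbound_def m_def)
  then have van_h: "dcoeff h i f = (\<lambda>_. 0)" if "i \<ge> m" for i
    using f that unfolding D_def deg_less_def by auto
  \<comment> \<open>With this \<open>N\<close> the coefficient of \<open>Q\<close> at
    \<open>m - 1\<close> is the number to be shown zero.\<close>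
  define N where "N = m - 1 + j"
  define Q where "Q = (\<Sum>i<m. monom (dcoeff k (N - i) (dcoeff h i f) a) i)"
  have Q: "poly Q t = dcoeff (k + scale t h) N f a" for t
  proof -
    have "dcoeff (k + scale t h) N f a = (\<Sum>i\<le>N. t ^ i * dcoeff k (N - i) (dcoeff h i f) a)"
      by (rule dcoeff_direction_shift(2)[OF PF])
    also have "\<dots> = (\<Sum>i<m. t ^ i * dcoeff k (N - i) (dcoeff h i f) a)"
      using mpos by (intro sum.mono_neutral_right) (auto simp: N_def van_h dcoeff_0)
    also have "\<dots> = poly Q t" by (simp add: Q_def poly_sum poly_monom mult.commute)
    finally show ?thesis by simp
  qed
  have "degree Q \<le> m - 1"
    unfolding Q_def by (rule degree_sum_le) (auto intro: order_trans[OF degree_monom_le])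
  then have degQ: "degree Q < m" using mpos by linarith
  have "\<mu> c \<le> order c Q" if "Q \<noteq> 0" for c
  proof (rule order_ge_if_shift_coeffs_zero[OF _ that])
    fix b assume b: "b < \<mu> c"
    \<comment> \<open>The Taylor expansion of \<open>Q\<close> at \<open>c\<close>, with
      \<open>k + scale c h\<close> innermost so that the bound in that direction applies.\<close>
    define R where "R = (\<Sum>w\<le>N. monom (dcoeff h (N - w) (dcoeff (k + scale c h) w f) a) (N - w))"
    have "pcompose Q [:c, 1:] = R"
      unfolding poly_eq_poly_eq_iff[symmetric]
    proof
      fix u
      have "poly (pcompose Q [:c, 1:]) u = dcoeff ((k + scale c h) + scale u h) N f a"
        by (simp add: poly_pcompose Q scale_left_distrib add.assoc)
      also have "\<dots> = poly R u"
        unfolding dcoeff_direction_shift(1)[OF PF] R_def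
        by (simp add: poly_sum poly_monom mult.commute)
      finally show "poly (pcompose Q [:c, 1:]) u = poly R u" .
    qed
    moreover have "dcoeff h (N - w) (dcoeff (k + scale c h) w f) a = 0" if "w \<le> N" "N - w = b" for w
    proof -
      \<comment> \<open>Here \<open>w = m - 1 + j - b\<close>. The strict inequality
        \<open>b < \<mu> c\<close> makes up for the \<open>- 1\<close>, so \<open>w\<close> just
        reaches the bound.\<close>
      have "\<mu> c \<le> m" unfolding \<mu>_def cardJ[symmetric] by (intro card_mono fin) auto
      then have "w \<ge> rho (loc A h) k + m - \<mu> c - \<epsilon>"
        using that b j \<epsilon>le unfolding N_def by linarith
      then have "dcoeff (k + scale c h) w f = (\<lambda>_. 0)" using van by blast
      then show ?thesis by (simp add: dcoeff_0)
    qed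
    ultimately show "coeff (pcompose Q [:c, 1:]) b = 0"
      unfolding R_def by (auto simp: coeff_sum intro!: sum.neutral)
  qed
  \<comment> \<open>Each \<open>i\<close> in \<open>J\<close> vanishes at
    \<open>k + scale c h\<close> for exactly one \<open>c\<close>, so the orders count every element
    of \<open>J\<close> once.\<close>
  moreover have "(\<Sum>c\<in>(\<lambda>i. - l i k / l i h) ` J. \<mu> c) = m"
  proof -
    have "{i \<in> J. l i (k + scale c h) = 0} = {i \<in> J. - l i k / l i h = c}" for c
      by (auto simp: J_def loc_def l_add l_scale field_simps add_eq_0_iff)
    then have "\<mu> c = (\<Sum>i\<in>{i \<in> J. - l i k / l i h = c}. 1)" for c by (simp add: \<mu>_def)
    then show ?thesis
      using sum.image_gen[OF fin(1), of "\<lambda>_. 1::nat" "\<lambda>i. - l i k / l i h"] cardJ by simp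
  qed
  ultimately have "Q = 0"
    using proots_mult_le_degree[of Q "(\<lambda>i. - l i k / l i h) ` J" \<mu>] fin degQ by fastforce
  then have "coeff Q (m - 1) = 0" by simp
  moreover have "coeff Q (m - 1) = dcoeff k j (dcoeff h (m - 1) f) a"
    using mpos by (simp add: Q_def coeff_sum N_def)
  ultimately show "dcoeff k j (dcoeff h (rho A h - 1) f) a = 0" by (simp add: m_def)
qed

lemma top_coeff_shift_invariant:
  assumes "f \<in> PF" "deg_less h m f" "m > 0"
  shows "dcoeff h (m - 1) f (a + scale s h) = dcoeff h (m - 1) f a"
proof -
  let ?p = "line_poly f h a"
  have "line_poly f h (a + scale s h) = pcompose ?p [:s, 1:]"
    by (rule line_poly_eqI)
      (simp add: poly_pcompose poly_line_poly assms scale_left_distrib add.assoc)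
  moreover have "coeff (pcompose ?p [:s, 1:]) (m - 1) = coeff ?p (m - 1)"
  proof (cases "degree ?p = m - 1")
    case True
    then show ?thesis using lead_coeff_comp[of "[:s, 1:]" ?p] by (simp add: degree_pcompose)
  next
    case False
    have "degree ?p \<le> m - 1"
      using assms(2,3) unfolding deg_less_def dcoeff_def
      by (intro degree_le) auto
    then show ?thesis using False by (simp add: coeff_eq_0 degree_pcompose)
  qed
  ultimately show ?thesis by (simp add: dcoeff_def)
qed

text \<open>If \<open>k\<close> is a multiple of \<open>h\<close> modulo \<open>kern A\<close>, the
  coefficient is constant along \<open>k\<close>: it is invariant under \<open>h\<close> as a top
  coefficient, and under \<open>kern A\<close> because \<open>f\<close> is. All other directions are
  covered by \<open>residue_deg_less\<close>.\<close>

lemma residue_in_D: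
  assumes A: "finite A" "E \<subseteq> A" and f: "f \<in> D A E"
    and h: "h \<notin> kern A" "\<And>i. i \<in> E \<Longrightarrow> l i h = 0"
  shows "dcoeff h (rho A h - 1) f \<in> D (loc A h) E"
proof -
  let ?g = "dcoeff h (rho A h - 1) f"
  have PF: "f \<in> PF" using D_PF f .
  have gPF: "?g \<in> PF" by (rule dcoeff_PF[OF PF])
  have pos: "rho A h > 0" using h(1) A rho_pos unfolding kern_def by blast
  have "dbound A E h = rho A h" using h by (auto simp: dbound_def)
  then have deg_h: "deg_less h (rho A h) f" using f unfolding D_def by (metis (lifting) mem_Collect_eq)
  have EF: "E \<subseteq> loc A h" using A h by (auto simp: loc_def)
  have "deg_less k (dbound (loc A h) E k) ?g" for k
  proof (cases "\<exists>c. k + scale c h \<in> kern A")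
    case True
    then obtain c where c: "k + scale c h \<in> kern A" ..
    then have "k \<in> kern (loc A h)" by (auto simp: kern_def loc_def l_add l_scale)
    moreover have "?g (a + scale t k) = ?g a" for a t
    proof -
      have "line_poly f h (b + scale t (k + scale c h)) = line_poly f h b" for b
      proof (rule line_poly_eqI)
        fix s
        have "b + scale t (k + scale c h) + scale s h = (b + scale s h) + scale t (k + scale c h)"
          by (simp add: add_ac)
        then show "f (b + scale t (k + scale c h) + scale s h) = poly (line_poly f h b) s"
          by (simp only: D_kern_invariant[OF f kern_scale[OF c]] poly_line_poly[OF PF])
      qed
      then have "?g (a + scale (- (t * c)) h + scale t (k + scale c h)) = ?g (a + scale (- (t * c)) h)"
        by (simp add: dcoeff_def)
      then show ?thesis
        using top_coeff_shift_invariant[OF PF deg_h pos, of a "- (t * c)"]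
        by (simp add: scale_right_distrib add_ac)
    qed
    ultimately show ?thesis using deg_less_Suc_0_iff[OF gPF] by (simp add: dbound_def)
  next
    case False
    then have *: "deg_less k (rho (loc A h) k - (if \<exists>i\<in>E. l i k \<noteq> 0 then 1 else 0)) ?g"
      using residue_deg_less[OF A f h] by blast
    show ?thesis
    proof (cases "k \<in> kern (loc A h)")
      case True
      then show ?thesis using deg_less_mono[OF *] by (simp add: dbound_def rho_eq_0)
    next
      case False
      then show ?thesis using * by (simp add: dbound_def)
    qed
  qed
  then show ?thesis using gPF by (simp add: D_def)
qed

text \<open>If \<open>h\<close> is not a ray, some \<open>x\<close> in \<open>kern (loc A h)\<close>
  is not a multiple of \<open>h\<close> modulo \<open>kern A\<close>. No functional of
  \<open>loc A h\<close> sees \<open>x\<close>, so the degree bound along \<open>x\<close> is 0.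
  Hence only flats of corank one contribute.\<close>

lemma residue_eq_0:
  assumes A: "finite A" "E \<subseteq> A" and f: "f \<in> D A E"
    and h: "h \<notin> kern A" "\<And>i. i \<in> E \<Longrightarrow> l i h = 0" and "\<not> is_ray A h"
  shows "dcoeff h (rho A h - 1) f v = 0"
proof -
  obtain x where x: "x \<in> kern (loc A h)" "\<And>c. x + scale c h \<notin> kern A"
    using assms(6) h(1) by (auto simp: is_ray_def)
  have "deg_less x 0 (dcoeff h (rho A h - 1) f)"
    using residue_deg_less[OF A f h x(2)] unfolding rho_eq_0[OF x(1)] by simp
  then show ?thesis using deg_less_0 dcoeff_PF D_PF[OF f] by blast
qed

section \<open>Splitting the residue map by products of functionals\<close>

definition lprod :: "nat set \<Rightarrow> 'v \<Rightarrow> complex" where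
  "lprod J v = (\<Prod>i\<in>J. l i v)"

lemma lprod_PF: "finite J \<Longrightarrow> lprod J \<in> PF"
  using PF_prod[of J l] l_PF by (simp add: lprod_def[abs_def])

lemma deg_less_lprod_mult:
  assumes "finite J" "g \<in> PF" "deg_less h b g"
  shows "deg_less h (card {i \<in> J. l i h \<noteq> 0} + b) (\<lambda>v. lprod J v * g v)"
  using deg_less_mult[OF lprod_PF assms(2) _ assms(3)] deg_less_prod_functionals[of J l h]
    functional_l assms(1)
  by (simp add: lprod_def[abs_def])

lemma dcoeff_lprod_mult:
  assumes "finite J" "g \<in> PF" "deg_less h 1 g" "\<And>i. i \<in> J \<Longrightarrow> l i h \<noteq> 0"
  shows "dcoeff h (card J) (\<lambda>v. lprod J v * g v) a = (\<Prod>i\<in>J. l i h) * g a"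
proof -
  let ?p = "\<Prod>i\<in>J. [:l i a, l i h:]"
  have "line_poly g h a = [:g a:]"
    using assms(2,3) deg_less_Suc_0_iff by (intro line_poly_eqI) simp
  moreover have "line_poly (lprod J) h a = ?p"
    using line_poly_prod[of J l] l_PF functional_l assms(1)
    by (simp add: lprod_def[abs_def] line_poly_functional)
  moreover have "degree ?p = card J"
    using assms(4) by (subst degree_prod_eq_sum_degree) auto
  moreover have "lead_coeff ?p = (\<Prod>i\<in>J. l i h)"
    using assms(4) by (subst lead_coeff_prod) (auto intro!: prod.cong)
  ultimately show ?thesis
    using line_poly_mult[OF lprod_PF[OF assms(1)] assms(2)] by (simp add: dcoeff_def mult.commute)
qed

lemma is_ray_multiple:
  assumes "is_ray A h" "x \<in> kern (loc A h)"
  obtains k c where "k \<in> kern A" "x = k + scale c h"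
proof -
  obtain c where "x + scale c h \<in> kern A" using assms by (auto simp: is_ray_def)
  then show thesis using that[of "x + scale c h" "- c"] by simp
qed

text \<open>Along \<open>k\<close>, the product adds one to the degree for each factor not vanishing
  at \<open>k\<close>. Leaving out \<open>e\<close> saves one degree where
  \<open>l e k \<noteq> 0\<close>: outside the kernel of the flat this gives the stronger second
  bound, which makes residues at other flats vanish.\<close>

lemma lprod_mult_in_D:
  assumes A: "finite A" "e \<in> A" "E \<subseteq> loc A h" and h: "is_ray A h" "l e h \<noteq> 0"
    and g: "g \<in> D (loc A h) E"
  defines "f \<equiv> \<lambda>v. lprod (A - loc A h - {e}) v * g v"
  shows "f \<in> D A E"
    and "k \<notin> kern (loc A h) \<Longrightarrow> l e k \<noteq> 0 \<Longrightarrow> deg_less k (dbound A E k - 1) f"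
proof -
  let ?F = "loc A h" and ?J = "A - loc A h - {e}"
  define x where "x k = card {i \<in> ?J. l i k \<noteq> 0}" for k
  have fin: "finite ?J" "finite ?F" using A by (auto simp: loc_def)
  have gPF: "g \<in> PF" using g by (rule D_PF)
  have eF: "e \<notin> ?F" using h by (simp add: loc_def)
  have deg: "deg_less k (x k + dbound ?F E k) f" for k
    unfolding f_def x_def using g by (intro deg_less_lprod_mult fin gPF) (simp add: D_def)
  have rho: "rho A k = rho ?F k + x k + (if l e k \<noteq> 0 then 1 else 0)" for k
  proof -
    have "{i \<in> A. l i k \<noteq> 0} = {i \<in> ?F. l i k \<noteq> 0} \<union> {i \<in> ?J. l i k \<noteq> 0} \<union> (if l e k \<noteq> 0 then {e} else {})"
      using A by (auto simp: loc_def)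
    then show ?thesis
      unfolding rho_def x_def using fin eF by (auto simp: card_Un_disjoint disjoint_iff)
  qed
  have big: "x k + dbound ?F E k \<le> dbound A E k - (if l e k \<noteq> 0 then 1 else 0)" if "k \<notin> kern ?F" for k
  proof -
    have "k \<notin> kern A" using that by (auto simp: kern_def loc_def)
    moreover have "(if \<exists>i\<in>E. l i k \<noteq> 0 then 1 else 0) \<le> rho ?F k"
      using rho_pos[OF fin(2)] A(3) by (fastforce simp: Suc_le_eq)
    ultimately show ?thesis using that rho[of k] unfolding dbound_def by (auto split: if_splits)
  qed
  show "deg_less k (dbound A E k - 1) f" if "k \<notin> kern ?F" "l e k \<noteq> 0"
    using deg_less_mono[OF deg[of k] big] that by simp
  have "x k + dbound ?F E k \<le> dbound A E k" for k
  proof (cases "k \<in> kern ?F")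
    case False
    then show ?thesis using big[of k] by linarith
  next
    \<comment> \<open>Inside the kernel of the flat the bound for \<open>g\<close> is 1 although
      \<open>rho\<close> of the flat is 0. The degree saved by omitting \<open>e\<close> pays for
      this excess, since \<open>k\<close> is a nonzero multiple of \<open>h\<close> modulo
      \<open>kern A\<close>.\<close>
    case True
    have E: "\<not> (\<exists>i\<in>E. l i k \<noteq> 0)" using True A(3) by (auto simp: kern_def)
    show ?thesis
    proof (cases "k \<in> kern A")
      case True
      then have "rho A k = 0" by (rule rho_eq_0)
      then show ?thesis using rho[of k] True \<open>k \<in> kern ?F\<close> by (simp add: dbound_def)
    next
      case False
      obtain u c where u: "u \<in> kern A" "k = u + scale c h"
        using is_ray_multiple[OF h(1) True] .
      then have "c \<noteq> 0" using False by auto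
      then have "l e k \<noteq> 0" using u A(2) h(2) by (simp add: l_add l_scale kern_def)
      then show ?thesis using rho[of k] True False E by (simp add: dbound_def)
    qed
  qed
  then show "f \<in> D A E"
    using deg deg_less_mono poly_funs.mult[OF lprod_PF[OF fin(1)] gPF] unfolding D_def f_def by blast
qed

section \<open>Residues at flats of corank one\<close>

definition ray_flats :: "nat set \<Rightarrow> nat set \<Rightarrow> nat \<Rightarrow> nat set set" where
  "ray_flats A E e = {loc A h | h. is_ray A h \<and> E \<subseteq> loc A h \<and> l e h \<noteq> 0}"

text \<open>A choice of direction is harmless: on \<open>D A E\<close>, with \<open>E\<close>
  contained in \<open>F\<close>, another direction with the same flat only multiplies the residue by
  a nonzero scalar.\<close>

definition ray :: "nat set \<Rightarrow> nat set \<Rightarrow> 'v" where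
  "ray A F = (SOME h. is_ray A h \<and> loc A h = F)"

definition residue :: "nat set \<Rightarrow> nat set \<Rightarrow> ('v \<Rightarrow> complex) \<Rightarrow> 'v \<Rightarrow> complex" where
  "residue A F f = dcoeff (ray A F) (card (A - F) - 1) f"

lemma ray_flats_ray:
  assumes "e \<in> A" "F \<in> ray_flats A E e"
  shows "is_ray A (ray A F)" "loc A (ray A F) = F" "E \<subseteq> F" "l e (ray A F) \<noteq> 0" "e \<notin> F"
    "F \<subseteq> A" "ray A F \<notin> kern A"
proof -
  obtain h where h: "is_ray A h \<and> loc A h = F" "E \<subseteq> F" "l e h \<noteq> 0"
    using assms by (auto simp: ray_flats_def)
  have "is_ray A (ray A F) \<and> loc A (ray A F) = F"
    unfolding ray_def using h(1) by (rule someI)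
  then show *: "is_ray A (ray A F)" "loc A (ray A F) = F" by simp_all
  show "E \<subseteq> F" by fact
  show "e \<notin> F" using h by (auto simp: loc_def)
  then show "l e (ray A F) \<noteq> 0" using *(2) assms(1) by (auto simp: loc_def)
  show "F \<subseteq> A" using *(2) by (auto simp: loc_def)
  show "ray A F \<notin> kern A" using *(1) by (simp add: is_ray_def)
qed

lemma finite_ray_flats: "finite A \<Longrightarrow> finite (ray_flats A E e)"
  by (rule finite_subset[of _ "Pow A"]) (auto simp: ray_flats_def loc_def)

text \<open>The two bounds differ, by one, only along those \<open>h\<close> outside
  \<open>kern A\<close> where \<open>E\<close> vanishes and \<open>l e\<close> does not. There the
  coefficient at \<open>rho A h - 1\<close> must vanish. It does so automatically off the rays, and
  on a ray it is a multiple of the residue.\<close>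

lemma D_insert_iff:
  assumes A: "finite A" "E \<subseteq> A" "e \<in> A"
  shows "f \<in> D A (insert e E) \<longleftrightarrow> f \<in> D A E \<and> (\<forall>F\<in>ray_flats A E e. residue A F f = 0)"
proof
  assume f: "f \<in> D A (insert e E)"
  have "dbound A (insert e E) h \<le> dbound A E h" for h by (simp add: dbound_def)
  then have "f \<in> D A E" using f deg_less_mono unfolding D_def by blast
  moreover have "residue A F f = 0" if "F \<in> ray_flats A E e" for F
  proof -
    note R = ray_flats_ray[OF A(3) that]
    have "dbound A (insert e E) (ray A F) = card (A - F) - 1"
      using R rho_loc[OF A(1), of "ray A F"] by (simp add: dbound_def)
    then show ?thesis
      using f unfolding D_def deg_less_def residue_def by (auto simp: fun_eq_iff) 
  qed
  ultimately show "f \<in> D A E \<and> (\<forall>F\<in>ray_flats A E e. residue A F f = 0)" by blast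
next
  assume f: "f \<in> D A E \<and> (\<forall>F\<in>ray_flats A E e. residue A F f = 0)"
  then have fD: "f \<in> D A E" and PF: "f \<in> PF" by (auto intro: D_PF)
  have "deg_less h (dbound A (insert e E) h) f" for h
  proof (cases "h \<in> kern A \<or> (\<exists>i\<in>E. l i h \<noteq> 0) \<or> l e h = 0")
    case True
    then have "dbound A (insert e E) h = dbound A E h" by (auto simp: dbound_def)
    then show ?thesis using fD by (simp add: D_def)
  next
    case False
    then have h: "h \<notin> kern A" "\<And>i. i \<in> E \<Longrightarrow> l i h = 0" "l e h \<noteq> 0" by auto
    have b: "dbound A E h = rho A h" "dbound A (insert e E) h = rho A h - 1"
      using h by (auto simp: dbound_def)
    have "dcoeff h (rho A h - 1) f a = 0" for a
    proof (cases "is_ray A h")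
      case False
      then show ?thesis using residue_eq_0[OF A(1,2) fD h(1,2)] by blast
    next
      case True
      have F: "loc A h \<in> ray_flats A E e"
        using True h A(2) by (auto simp: ray_flats_def loc_def)
      note R = ray_flats_ray[OF A(3) F]
      have "h \<in> kern (loc A h)" by (auto simp: kern_def loc_def)
      then obtain k c where k: "k \<in> kern A" "h = k + scale c (ray A (loc A h))"
        using is_ray_multiple[OF R(1)] R(2) by metis
      let ?r = "ray A (loc A h)"
      \<comment> \<open>Since \<open>f\<close> is invariant under \<open>kern A\<close>, only the
        multiple of the chosen ray in \<open>h\<close> matters.\<close>
      have "line_poly f h a = pcompose (line_poly f ?r a) [:0, c:]"
      proof (rule line_poly_eqI)
        fix t
        have "a + scale t h = (a + scale (t * c) ?r) + scale t k"
          by (subst k(2)) (simp add: scale_right_distrib add_ac)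
        then show "f (a + scale t h) = poly (pcompose (line_poly f ?r a) [:0, c:]) t"
          by (simp only: D_kern_invariant[OF fD kern_scale[OF k(1)]])
            (simp add: poly_pcompose poly_line_poly[OF PF])
      qed
      then have "dcoeff h (rho A h - 1) f a = c ^ (rho A h - 1) * residue A (loc A h) f a"
        by (simp add: dcoeff_def residue_def coeff_pcompose_linear rho_loc[OF A(1)])
      then show ?thesis using f F by simp
    qed
    moreover have "deg_less h (rho A h) f" using fD b(1) unfolding D_def by (metis (lifting) mem_Collect_eq)
    ultimately show ?thesis unfolding b(2) deg_less_def
      by (metis One_nat_def Suc_pred le_neq_implies_less less_eq_Suc_le neq0_conv diff_is_0_eq' le_0_eq zero_le)
  qed
  then show "f \<in> D A (insert e E)" using PF by (simp add: D_def)
qed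

section \<open>Graded pieces and the recursion for Hilbert series\<close>

text \<open>This is the piece of degree \<open>d - p\<close>, or zero if \<open>p\<close> exceeds
  \<open>d\<close>, in the form in which \<open>dcoeff_hom\<close> yields it.\<close>

definition scaledD :: "nat set \<Rightarrow> nat set \<Rightarrow> nat \<Rightarrow> nat \<Rightarrow> ('v \<Rightarrow> complex) set" where
  "scaledD F E p d = {g \<in> D F E. \<forall>c v. c ^ p * g (scale c v) = c ^ d * g v}"

lemma scaledD_eq: "scaledD F E p d = (if p \<le> d then homD F E (d - p) else {0})"
proof -
  have "0 \<in> D F E" using fun_vs.subspace_0[OF subspace_D] .
  then have "(g \<in> scaledD F E p d) = (g \<in> (if p \<le> d then homD F E (d - p) else {0}))" for g
    using scaled_hom_iff[OF D_PF, of g F E p d] fun_eq_iff[of g 0]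
    by (auto simp: scaledD_def homD_def split: if_splits)
  then show ?thesis by blast
qed

lemma subspace_homD: "fun_vs.subspace (homD A E d)"
  using subspace_D[of A E]
  by (auto simp: homD_def fun_vs.subspace_def fun_scale_def algebra_simps)

lemma subspace_scaledD: "fun_vs.subspace (scaledD F E p d)"
  by (auto simp: scaledD_eq subspace_homD)

lemma residue_add: "f \<in> PF \<Longrightarrow> g \<in> PF \<Longrightarrow> residue A F (f + g) = residue A F f + residue A F g"
  by (simp add: residue_def dcoeff_def plus_fun_def line_poly_add)

lemma residue_scale: "f \<in> PF \<Longrightarrow> residue A F (fun_scale c f) = fun_scale c (residue A F f)"
  by (simp add: residue_def dcoeff_def fun_scale_def line_poly_cmult)

lemma residue_in_scaledD:
  assumes A: "finite A" "E \<subseteq> A" "e \<in> A" and F: "F \<in> ray_flats A E e" and f: "f \<in> homD A E d"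
  shows "residue A F f \<in> scaledD F E (card (A - F) - 1) d"
proof -
  note R = ray_flats_ray[OF A(3) F]
  have f': "f \<in> D A E" "f \<in> PF" "\<And>c v. f (scale c v) = c ^ d * f v"
    using f by (auto simp: homD_def intro: D_PF)
  have "l i (ray A F) = 0" if "i \<in> E" for i using R(2,3) that by (auto simp: loc_def)
  then have "residue A F f \<in> D F E"
    using residue_in_D[OF A(1,2) f'(1) R(7)] rho_loc[OF A(1), of "ray A F"] R(2)
    by (simp add: residue_def)
  then show ?thesis
    using dcoeff_hom[OF f'(2,3)] by (simp add: scaledD_def residue_def)
qed

text \<open>The product with \<open>lprod J\<close> has residue \<open>c\<close> times
  \<open>g\<close> at \<open>F\<close>, where \<open>c\<close> is nonzero, and its degree is too
  small to leave a residue at any other flat. Dividing by \<open>c\<close> gives the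
  preimage.\<close>

lemma residue_section:
  assumes A: "finite A" "E \<subseteq> A" "e \<in> A" and F: "F \<in> ray_flats A E e"
    and g: "g \<in> scaledD F E (card (A - F) - 1) d"
  shows "\<exists>f\<in>homD A E d. residue A F f = g \<and> (\<forall>F'\<in>ray_flats A E e - {F}. residue A F' f = 0)"
proof -
  note R = ray_flats_ray[OF A(3) F]
  define J where "J = A - F - {e}"
  define f where "f v = lprod J v * g v" for v
  define c where "c = (\<Prod>i\<in>J. l i (ray A F))"
  have finJ: "finite J" using A by (simp add: J_def)
  have cardJ: "card J = card (A - F) - 1" using A R by (simp add: J_def)
  have gD: "g \<in> D F E" and gh: "\<And>c v. c ^ card J * g (scale c v) = c ^ d * g v"
    using g by (auto simp: scaledD_def cardJ)
  have gPF: "g \<in> PF" using gD by (rule D_PF)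
  have fD: "f \<in> D A E"
    and deg: "\<And>k. k \<notin> kern F \<Longrightarrow> l e k \<noteq> 0 \<Longrightarrow> deg_less k (dbound A E k - 1) f"
    using lprod_mult_in_D[of A e E "ray A F" g] A R gD unfolding f_def[abs_def] J_def by auto
  have nz: "l i (ray A F) \<noteq> 0" if "i \<in> J" for i using that R(2) by (auto simp: J_def loc_def)
  then have c0: "c \<noteq> 0" using finJ by (simp add: c_def)
  have "lprod J (scale x v) = x ^ card J * lprod J v" for x v
    by (simp add: lprod_def l_scale prod.distrib)
  then have "f (scale x v) = x ^ d * f v" for x v
    using gh[of x v] by (simp add: f_def mult.assoc mult.left_commute)
  then have fhom: "f \<in> homD A E d" using fD by (simp add: homD_def)
  have "ray A F \<in> kern F" using R(2) by (auto simp: kern_def loc_def)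
  then have "dbound F E (ray A F) = 1" by (simp add: dbound_def)
  then have "deg_less (ray A F) 1 g" using gD unfolding D_def by (metis (lifting) mem_Collect_eq)
  then have res: "residue A F f = fun_scale c g"
    using dcoeff_lprod_mult[OF finJ gPF _ nz] unfolding cardJ
    by (simp add: residue_def f_def[abs_def] c_def fun_scale_def fun_eq_iff)
  have res': "residue A F' f = 0" if F': "F' \<in> ray_flats A E e" "F' \<noteq> F" for F'
  proof -
    note R' = ray_flats_ray[OF A(3) F'(1)]
    \<comment> \<open>Otherwise the two rays would be proportional modulo \<open>kern A\<close> and
      define the same flat.\<close>
    have "ray A F' \<notin> kern F"
    proof
      assume "ray A F' \<in> kern F"
      then obtain k x where k: "k \<in> kern A" "ray A F' = k + scale x (ray A F)"
        using is_ray_multiple[OF R(1)] R(2) by metis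
      then have "x \<noteq> 0" using R'(7) by auto
      then have "loc A (ray A F') = loc A (ray A F)"
        using k by (auto simp: loc_def kern_def l_add l_scale)
      then show False using F'(2) R(2) R'(2) by simp
    qed
    moreover have "dbound A E (ray A F') = card (A - F')"
      using R' rho_loc[OF A(1), of "ray A F'"] by (auto simp: dbound_def loc_def)
    ultimately have "deg_less (ray A F') (card (A - F') - 1) f" using deg R'(4) by metis
    then show ?thesis by (auto simp: residue_def deg_less_def fun_eq_iff)
  qed
  have "residue A F (fun_scale (1 / c) f) = g"
    using c0 residue_scale[OF D_PF[OF fD], of A F "1 / c"] res by (simp add: fun_scale_def fun_eq_iff)
  moreover have "residue A F' (fun_scale (1 / c) f) = 0" if "F' \<in> ray_flats A E e - {F}" for F'
    using residue_scale[OF D_PF[OF fD], of A F' "1 / c"] res'[of F'] that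
    by (simp add: fun_scale_def fun_eq_iff)
  moreover have "fun_scale (1 / c) f \<in> homD A E d"
    using fun_vs.subspace_scale[OF subspace_homD fhom] .
  ultimately show ?thesis by blast
qed

text \<open>Impose the vanishing of residues one flat at a time and apply
  \<open>rank_nullity_on\<close> at each step. The map stays surjective on \<open>W \<G>\<close>
  because the section at \<open>F\<close> has zero residue at all other flats. Finiteness passes
  both ways, as the final induction requires.\<close>

lemma dim_homD_recursion:
  assumes A: "finite A" "E \<subseteq> A" "e \<in> A"
    and fin: "\<And>F d. F \<in> ray_flats A E e \<Longrightarrow> findim (homD F E d)"
  shows "findim (homD A E d) \<longleftrightarrow> findim (homD A (insert e E) d)"
    and "findim (homD A E d) \<Longrightarrow> fun_vs.dim (homD A E d) = fun_vs.dim (homD A (insert e E) d) +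
      (\<Sum>F\<in>ray_flats A E e. fun_vs.dim (scaledD F E (card (A - F) - 1) d))"
proof -
  define W where "W \<G> = {f \<in> homD A E d. \<forall>F\<in>\<G>. residue A F f = 0}" for \<G>
  define T where "T F = scaledD F E (card (A - F) - 1) d" for F
  have PF: "f \<in> PF" if "f \<in> homD A E d" for f using that D_PF by (auto simp: homD_def)
  have subW: "fun_vs.subspace (W \<G>)" for \<G>
  proof (rule fun_vs.subspaceI)
    have z: "0 \<in> homD A E d" by (rule fun_vs.subspace_0[OF subspace_homD])
    then show "0 \<in> W \<G>"
      using residue_scale[OF PF[OF z], of A _ 0] by (simp add: W_def)
  next
    fix f g assume "f \<in> W \<G>" "g \<in> W \<G>"
    then show "f + g \<in> W \<G>"
      using fun_vs.subspace_add[OF subspace_homD] by (simp add: W_def residue_add PF)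
  next
    fix c f assume "f \<in> W \<G>"
    then show "fun_scale c f \<in> W \<G>"
      using fun_vs.subspace_scale[OF subspace_homD] by (simp add: W_def residue_scale PF)
  qed
  have W_top: "W (ray_flats A E e) = homD A (insert e E) d"
    using D_insert_iff[OF A] by (auto simp: W_def homD_def)
  have W_empty: "W {} = homD A E d" by (simp add: W_def)
  have finT: "findim (T F)" if "F \<in> ray_flats A E e" for F
    using fin[OF that] by (auto simp: T_def scaledD_eq findim_def intro: exI[of _ "{0}"] fun_vs.span_zero)
  have "\<G> \<subseteq> ray_flats A E e \<Longrightarrow> findim (W \<G>) \<Longrightarrow>
      findim (W {}) \<and> fun_vs.dim (W {}) = fun_vs.dim (W \<G>) + (\<Sum>F\<in>\<G>. fun_vs.dim (T F))"
    if "finite \<G>" for \<G>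
    using that
  proof (induction \<G>)
    case empty
    then show ?case by simp
  next
    case (insert F \<G>)
    have F: "F \<in> ray_flats A E e" using insert.prems by simp
    have ker: "{f \<in> W \<G>. residue A F f = 0} = W (insert F \<G>)" by (auto simp: W_def)
    have subT: "fun_vs.subspace (T F)" unfolding T_def by (rule subspace_scaledD)
    have resT: "residue A F f \<in> T F" if "f \<in> W \<G>" for f
      using that residue_in_scaledD[OF A F] by (auto simp: T_def W_def)
    have add: "residue A F (f + g) = residue A F f + residue A F g" if "f \<in> W \<G>" "g \<in> W \<G>" for f g
      using that by (auto simp: W_def PF residue_add)
    have scl: "residue A F (fun_scale c f) = fun_scale c (residue A F f)" if "f \<in> W \<G>" for c f
      using that by (auto simp: W_def PF residue_scale)
    have surj: "\<exists>f\<in>W \<G>. residue A F f = g" if "g \<in> T F" for g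
      using residue_section[OF A F, of g d] that insert.prems insert.hyps
      unfolding T_def W_def by blast
    have "findim {f \<in> W \<G>. residue A F f = 0}" using insert.prems by (simp add: ker)
    note rank_nullity_on[OF subW subT resT add scl surj this finT[OF F]]
    then show ?case using insert by (simp add: ker)
  qed
  from this[OF finite_ray_flats[OF A(1)] order_refl]
  have main: "findim (homD A (insert e E) d) \<Longrightarrow> findim (homD A E d) \<and>
      fun_vs.dim (homD A E d) = fun_vs.dim (homD A (insert e E) d) + (\<Sum>F\<in>ray_flats A E e. fun_vs.dim (T F))"
    unfolding W_top W_empty .
  have "findim (homD A E d) \<Longrightarrow> findim (homD A (insert e E) d)"
    by (rule findim_subset) (auto simp: W_top[symmetric] W_def)
  then show "findim (homD A E d) \<longleftrightarrow> findim (homD A (insert e E) d)"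
    and "findim (homD A E d) \<Longrightarrow> fun_vs.dim (homD A E d) = fun_vs.dim (homD A (insert e E) d) +
      (\<Sum>F\<in>ray_flats A E e. fun_vs.dim (scaledD F E (card (A - F) - 1) d))"
    using main by (auto simp: T_def)
qed

definition HS :: "nat set \<Rightarrow> nat set \<Rightarrow> rat fps" where
  "HS A E = Abs_fps (\<lambda>d. of_nat (fun_vs.dim (homD A E d)))"

lemma HS_recursion:
  assumes "finite A" "E \<subseteq> A" "e \<in> A"
    and "\<And>F d. F \<in> ray_flats A E e \<Longrightarrow> findim (homD F E d)"
    and "\<And>d. findim (homD A E d)"
  shows "HS A E = HS A (insert e E) + (\<Sum>F\<in>ray_flats A E e. fps_X ^ (card (A - F) - 1) * HS F E)"
proof (rule fps_ext)
  fix d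
  have "of_nat (fun_vs.dim (scaledD F E p d)) = fps_nth (fps_X ^ p * HS F E) d" for F p
  proof -
    have "fun_vs.dim {0 :: 'v \<Rightarrow> complex} \<le> card ({} :: ('v \<Rightarrow> complex) set)"
      by (rule fun_vs.dim_le_card) auto
    then show ?thesis by (auto simp: scaledD_eq HS_def fps_X_power_mult_nth)
  qed
  then show "fps_nth (HS A E) d =
      fps_nth (HS A (insert e E) + (\<Sum>F\<in>ray_flats A E e. fps_X ^ (card (A - F) - 1) * HS F E)) d"
    using dim_homD_recursion(2)[OF assms(1-4) assms(5)[of d]]
    by (simp add: HS_def[of A] fps_sum_nth)
qed

section \<open>Deletion, coloops and the empty arrangement\<close>

text \<open>Equality of the kernels says that \<open>e\<close> is not a coloop; lowering the bound
  by one where \<open>l e\<close> is nonzero then amounts to deleting \<open>e\<close>. For a coloop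
  there is a direction seen by \<open>e\<close> alone, and the bound there is 0.\<close>

lemma D_singleton:
  assumes "finite A" "e \<in> A"
  shows "kern (A - {e}) = kern A \<Longrightarrow> D A {e} = D (A - {e}) {}"
    and "kern (A - {e}) \<noteq> kern A \<Longrightarrow> D A {e} = {0}"
proof -
  assume k: "kern (A - {e}) = kern A"
  have "dbound A {e} h = dbound (A - {e}) {} h" for h
  proof -
    have "{i \<in> A. l i h \<noteq> 0} = (if l e h \<noteq> 0 then insert e else id) {i \<in> A - {e}. l i h \<noteq> 0}"
      using assms(2) by auto
    then have "rho A h = rho (A - {e}) h + (if l e h \<noteq> 0 then 1 else 0)"
      using assms(1) by (auto simp: rho_def)
    then show ?thesis by (auto simp: dbound_def k)
  qed
  then show "D A {e} = D (A - {e}) {}" by (simp add: D_def)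
next
  assume "kern (A - {e}) \<noteq> kern A"
  then obtain h where h: "h \<in> kern (A - {e})" "h \<notin> kern A"
    using kern_mono[of "A - {e}" A] by blast
  then have e: "l e h \<noteq> 0" by (auto simp: kern_def)
  then have "{i \<in> A. l i h \<noteq> 0} = {e}" using h(1) assms(2) by (auto simp: kern_def)
  then have b: "dbound A {e} h = 0" using h(2) e by (simp add: dbound_def rho_def)
  have "f = 0" if f: "f \<in> D A {e}" for f
  proof -
    have "deg_less h (dbound A {e} h) f" using f by (simp add: D_def)
    then show ?thesis using deg_less_0[OF D_PF[OF f]] b by (simp add: fun_eq_iff)
  qed
  then show "D A {e} = {0}" using fun_vs.subspace_0[OF subspace_D, of A "{e}"] by blast
qed

lemma homD_empty: "homD {} {} d = (if d = 0 then fun_vs.span {\<lambda>_. 1} else {0})"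
proof -
  have D: "D {} {} = range (\<lambda>c _. c)"
  proof (intro equalityI subsetI)
    fix f assume "f \<in> D {} {}"
    then have "f v = f 0" for v
      using D_kern_invariant[of f "{}" "{}" v 0] by (simp add: kern_def)
    then have "f = (\<lambda>_. f 0)" by (simp add: fun_eq_iff)
    then show "f \<in> range (\<lambda>c _. c)" by (rule range_eqI)
  next
    fix f :: "'v \<Rightarrow> complex" assume "f \<in> range (\<lambda>c _. c)"
    then obtain c where f: "f = (\<lambda>_. c)" by blast
    have "deg_less h 1 f" for h
      using deg_less_Suc_0_iff[OF poly_funs.const[of c scale]] by (simp add: f)
    then show "f \<in> D {} {}" by (simp add: D_def dbound_def kern_def f poly_funs.const)
  qed
  have "f \<in> homD {} {} d \<longleftrightarrow> f \<in> (if d = 0 then fun_vs.span {\<lambda>_. 1} else {0})" for f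
  proof (cases "d = 0")
    case True
    have "fun_vs.span {\<lambda>_. 1} = range (\<lambda>c _::'v. c)"
      by (simp add: fun_vs.span_singleton fun_scale_def)
    then show ?thesis using True by (auto simp: homD_def D)
  next
    case False
    then have "(\<forall>c::complex. x = c ^ d * x) \<longleftrightarrow> x = 0" for x :: complex
      by (metis mult_zero_left mult_zero_right power_0_left)
    then show ?thesis using False by (auto simp: homD_def D zero_fun_def)
  qed
  then show ?thesis by blast
qed

section \<open>Rank and nullity through common kernels\<close>

text \<open>In the induction, either \<open>l e\<close> vanishes on \<open>kern S\<close> and
  changes nothing, or \<open>kern S\<close> is \<open>kern (insert e S)\<close> plus one line, and
  subtracting a multiple of \<open>l e\<close> makes \<open>\<phi>\<close> vanish on that line as
  well.\<close>

lemma mem_span_l_iff: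
  assumes "finite S" "\<And>x y. \<phi> (x + y) = \<phi> x + \<phi> y" "\<And>c x. \<phi> (scale c x) = c * \<phi> x"
  shows "\<phi> \<in> fun_vs.span (l ` S) \<longleftrightarrow> (\<forall>v\<in>kern S. \<phi> v = 0)"
proof
  have "fun_vs.subspace {\<phi>. \<forall>v\<in>kern S. \<phi> v = 0}"
    by (auto simp: fun_vs.subspace_def fun_scale_def)
  then have "fun_vs.span (l ` S) \<subseteq> {\<phi>. \<forall>v\<in>kern S. \<phi> v = 0}"
    by (intro fun_vs.span_minimal) (auto simp: kern_def)
  then show "\<phi> \<in> fun_vs.span (l ` S) \<Longrightarrow> \<forall>v\<in>kern S. \<phi> v = 0" by blast
next
  show "\<forall>v\<in>kern S. \<phi> v = 0 \<Longrightarrow> \<phi> \<in> fun_vs.span (l ` S)"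
    using assms
  proof (induction S arbitrary: \<phi> rule: finite_induct)
    case empty
    then have "\<phi> = 0" by (simp add: kern_def fun_eq_iff)
    then show ?case using fun_vs.span_zero by blast
  next
    case (insert e S)
    show ?case
    proof (cases "\<forall>v\<in>kern S. l e v = 0")
      case True
      then have "\<phi> \<in> fun_vs.span (l ` S)"
        using insert.prems by (intro insert.IH) (auto simp: kern_insert)
      then show ?thesis using fun_vs.span_mono[of "l ` S" "l ` insert e S"] by blast
    next
      case False
      then obtain h where h: "h \<in> kern S" "l e h \<noteq> 0" by blast
      define a where "a = \<phi> h / l e h"
      define \<psi> where "\<psi> = \<phi> - fun_scale a (l e)"
      have \<psi>: "\<psi> v = \<phi> v - a * l e v" for v by (simp add: \<psi>_def fun_scale_def)
      have "\<psi> v = 0" if "v \<in> kern S" for v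
      proof -
        have "v + scale (- (l e v / l e h)) h \<in> kern (insert e S)"
          using that h kern_add[OF that kern_scale[OF h(1)]]
          by (simp only: kern_insert) (simp add: l_add l_scale del: scale_minus_left)
        then have "\<phi> (v + scale (- (l e v / l e h)) h) = 0" using insert.prems(1) by blast
        then show ?thesis using h(2) by (simp add: insert.prems \<psi> a_def del: scale_minus_left)
      qed
      then have "\<psi> \<in> fun_vs.span (l ` S)"
        by (intro insert.IH) (simp_all add: \<psi> insert.prems l_add l_scale algebra_simps)
      then show ?thesis
        unfolding image_insert fun_vs.span_insert \<psi>_def by blast
    qed
  qed
qed

lemma rk_insert:
  assumes "finite S"
  shows "rk l (insert e S) = (if kern (insert e S) = kern S then rk l S else Suc (rk l S))"
proof -
  have span: "l e \<in> fun_vs.span (l ` S) \<longleftrightarrow> kern (insert e S) = kern S"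
    using mem_span_l_iff[OF assms, of "l e"] l_add l_scale by (auto simp: kern_insert)
  have fin: "findim (l ` S)" unfolding findim_def using assms fun_vs.span_superset[of "l ` S"] by (intro exI[of _ "l ` S"]) simp
  show ?thesis
  proof (cases "kern (insert e S) = kern S")
    case True
    then show ?thesis using span by (simp add: rk_def fun_vs.span_redundant del: fun_vs.dim_span)
  next
    case False
    then show ?thesis using findim_span_insert(2)[OF fin] span by (simp add: rk_def)
  qed
qed

lemma rk_empty: "rk l {} = 0"
  using fun_vs.dim_le_card[of "{0}" "{}"] by (simp add: rk_def)

text \<open>Each new element raises the rank by 0 or 1, so rank and nullity are both monotone; the
  second is written additively.\<close>

lemma rk_Un:
  assumes "finite S" "finite U"
  shows "rk l S \<le> rk l (S \<union> U) \<and> rk l (S \<union> U) + card S \<le> rk l S + card (S \<union> U)"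
  using assms(2)
proof (induction U rule: finite_induct)
  case empty
  show ?case by simp
next
  case (insert u U)
  then show ?case
    using assms(1) by (cases "u \<in> S \<union> U") (auto simp: insert_absorb rk_insert)
qed

lemma rk_mono: "finite T \<Longrightarrow> S \<subseteq> T \<Longrightarrow> rk l S \<le> rk l T"
  and rk_nullity_mono: "finite T \<Longrightarrow> S \<subseteq> T \<Longrightarrow> rk l T + card S \<le> rk l S + card T"
  using rk_Un[of S T] finite_subset[of S T] by (auto simp: Un_absorb1)

lemma rk_le_card: "finite S \<Longrightarrow> rk l S \<le> card S"
  using rk_nullity_mono[of S "{}"] rk_empty by simp

lemma rk_eq_if_kern_eq:
  assumes "finite T" "S \<subseteq> T" "kern S = kern T"
  shows "rk l S = rk l T"
proof -
  have "rk l (S \<union> U) = rk l S" if "finite U" "U \<subseteq> T" for U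
    using that
  proof (induction U rule: finite_induct)
    case (insert u U)
    have "kern T \<subseteq> kern (insert u (S \<union> U))" "kern (insert u (S \<union> U)) \<subseteq> kern S"
      "kern T \<subseteq> kern (S \<union> U)" "kern (S \<union> U) \<subseteq> kern S"
      by (rule kern_mono; use insert.prems assms(2) in blast)+
    then have "kern (insert u (S \<union> U)) = kern (S \<union> U)" using assms(3) by blast
    then show ?case
      using insert assms finite_subset[of S T] by (simp add: rk_insert)
  qed simp
  from this[of T] assms show ?thesis by (simp add: Un_absorb1)
qed

section \<open>The recursion for the Tutte sum\<close>

text \<open>The summand of \<open>S\<close> in the Tutte sum at \<open>(0, 1/q)\<close>, times
  \<open>q\<close> to the power \<open>n - r\<close>. Distributing \<open>q\<close> over the powers
  of \<open>1/q - 1\<close> leaves a power series; the exponent is nonnegative because nullity is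
  monotone.\<close>

definition tterm :: "nat set \<Rightarrow> nat set \<Rightarrow> rat fps" where
  "tterm A S = (- 1) ^ (rk l A - rk l S) * fps_X ^ ((card A - card S) - (rk l A - rk l S)) *
     (1 - fps_X) ^ (card S - rk l S)"

text \<open>The condition on \<open>S\<close> says that \<open>S \<union> E\<close> has the same rank as \<open>A\<close>.\<close>

definition TS :: "nat set \<Rightarrow> nat set \<Rightarrow> rat fps" where
  "TS A E = (\<Sum>S | S \<subseteq> A \<and> kern (S \<union> E) = kern A. tterm A S)"

lemma ray_flat_kern:
  assumes "e \<in> A" "F \<in> ray_flats A E e"
  shows "kern (insert e F) = kern A" "kern F \<noteq> kern A"
proof -
  note R = ray_flats_ray[OF assms]
  show "kern (insert e F) = kern A"
  proof
    show "kern A \<subseteq> kern (insert e F)" using R assms(1) by (intro kern_mono) auto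
    show "kern (insert e F) \<subseteq> kern A"
    proof
      fix x assume x: "x \<in> kern (insert e F)"
      then have "x \<in> kern (loc A (ray A F))" by (simp add: R(2) kern_insert)
      then obtain k c where k: "k \<in> kern A" "x = k + scale c (ray A F)"
        using is_ray_multiple[OF R(1)] by blast
      have "l e x = 0" using x by (simp add: kern_insert)
      moreover have "l e k = 0" using k(1) assms(1) by (simp add: kern_def)
      ultimately have "c = 0" using R(4) k(2) by (simp add: l_add l_scale)
      then show "x \<in> kern A" using k by simp
    qed
  qed
  have "ray A F \<in> kern F" using R(2) by (auto simp: kern_def loc_def)
  then show "kern F \<noteq> kern A" using R(7) by blast
qed

text \<open>The rank of \<open>F\<close> is one less than that of \<open>A\<close>: this flips the
  sign and accounts for the \<open>- 1\<close> in the exponent.\<close>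

lemma tterm_ray_flat:
  assumes "finite A" "e \<in> A" "F \<in> ray_flats A E e" "S \<subseteq> F"
  shows "tterm A S = - (fps_X ^ (card (A - F) - 1) * tterm F S)"
proof -
  note R = ray_flats_ray[OF assms(2,3)] and K = ray_flat_kern[OF assms(2,3)]
  have finF: "finite F" using R(6) assms(1) finite_subset by blast
  have "rk l (insert e F) = rk l A"
    using R(6) assms(1,2) K by (intro rk_eq_if_kern_eq) auto
  then have rA: "rk l A = Suc (rk l F)" using rk_insert[OF finF, of e] K by simp
  have le: "rk l S \<le> rk l F" "rk l F + card S \<le> rk l S + card F" "card S \<le> card F"
    using rk_mono[OF finF assms(4)] rk_nullity_mono[OF finF assms(4)] card_mono[OF finF assms(4)] by auto
  have card: "card (A - F) = card A - card F" "card F < card A"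
    using finF R(5,6) assms(1,2) by (auto simp: card_Diff_subset intro!: psubset_card_mono)
  have "card A - card S - (rk l A - rk l S) =
      (card (A - F) - 1) + (card F - card S - (rk l F - rk l S))"
    using le card rA by linarith
  moreover have "rk l A - rk l S = Suc (rk l F - rk l S)" using le rA by simp
  ultimately show ?thesis by (simp add: tterm_def power_add mult_ac)
qed

lemma TS_recursion:
  assumes A: "finite A" "E \<subseteq> A" "e \<in> A"
  shows "TS A E = TS A (insert e E) + (\<Sum>F\<in>ray_flats A E e. fps_X ^ (card (A - F) - 1) * TS F E)"
proof -
  let ?P = "\<lambda>A E. {S. S \<subseteq> A \<and> kern (S \<union> E) = kern A}"
  have fin: "finite (?P B E')" if "finite B" for B E'
    by (rule finite_subset[of _ "Pow B"]) (use that in auto)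
  \<comment> \<open>\<open>F\<close> is the closure of \<open>S \<union> E\<close>, so different
    flats share no \<open>S\<close>.\<close>
  have flat: "F = {i \<in> A. \<forall>v\<in>kern (S \<union> E). l i v = 0}"
    if F: "F \<in> ray_flats A E e" and S: "S \<in> ?P F E" for F S
  proof -
    note R = ray_flats_ray[OF A(3) F]
    have "ray A F \<in> kern F" using R(2) by (auto simp: kern_def loc_def)
    then have "i \<in> F" if "i \<in> A" "\<forall>v\<in>kern F. l i v = 0" for i
      using that R(2) by (auto simp: loc_def)
    then show ?thesis using S R(6) by (auto simp: kern_def)
  qed
  have "?P A (insert e E) - ?P A E = (\<Union>F\<in>ray_flats A E e. ?P F E)"
  proof (intro equalityI subsetI)
    fix S assume "S \<in> ?P A (insert e E) - ?P A E"
    then have S: "S \<subseteq> A" "kern (insert e (S \<union> E)) = kern A" "kern (S \<union> E) \<noteq> kern A" by auto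
    have "kern A \<subseteq> kern (S \<union> E)" using S A by (intro kern_mono) auto
    \<comment> \<open>Since \<open>l e\<close> cuts \<open>kern A\<close> out of
      \<open>kern (S \<union> E)\<close>, any such \<open>h\<close> spans the quotient and is a
      ray.\<close>
    then obtain h where h: "h \<in> kern (S \<union> E)" "h \<notin> kern A" using S by blast
    then have e: "l e h \<noteq> 0" using S(2) by (auto simp: kern_insert)
    have sub: "S \<union> E \<subseteq> loc A h" using h S A by (auto simp: kern_def loc_def)
    have ex: "\<exists>c. x + scale c h \<in> kern A" if "x \<in> kern (S \<union> E)" for x
    proof -
      have "x + scale (- (l e x / l e h)) h \<in> kern (S \<union> E)"
        using that h kern_add kern_scale by blast
      moreover have "l e (x + scale (- (l e x / l e h)) h) = 0"
        using e unfolding l_add l_scale by simp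
      ultimately have "x + scale (- (l e x / l e h)) h \<in> kern A"
        unfolding S(2)[symmetric] kern_insert by blast
      then show ?thesis ..
    qed
    have "is_ray A h" using ex h(2) kern_mono[OF sub] by (auto simp: is_ray_def)
    then have F: "loc A h \<in> ray_flats A E e" using sub e by (auto simp: ray_flats_def)
    have "kern (S \<union> E) \<subseteq> kern (loc A h)"
    proof
      fix x assume "x \<in> kern (S \<union> E)"
      then obtain c where "x + scale c h \<in> kern A" using ex by blast
      then show "x \<in> kern (loc A h)" by (auto simp: kern_def loc_def l_add l_scale)
    qed
    then have "S \<in> ?P (loc A h) E" using kern_mono[OF sub] sub by auto
    then show "S \<in> (\<Union>F\<in>ray_flats A E e. ?P F E)" using F by blast
  next
    fix S assume "S \<in> (\<Union>F\<in>ray_flats A E e. ?P F E)"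
    then obtain F where F: "F \<in> ray_flats A E e" and S: "S \<subseteq> F" "kern (S \<union> E) = kern F" by blast
    note R = ray_flats_ray[OF A(3) F] and K = ray_flat_kern[OF A(3) F]
    have "kern (S \<union> insert e E) = kern A" using K(1) S(2) by (simp add: kern_insert)
    then show "S \<in> ?P A (insert e E) - ?P A E" using S R K by auto
  qed
  moreover have sub: "?P A E \<subseteq> ?P A (insert e E)"
    using A(3) by (auto simp: kern_insert) (auto simp: kern_def)
  have "TS A (insert e E) = TS A E + sum (tterm A) (?P A (insert e E) - ?P A E)"
    unfolding TS_def using sum.subset_diff[OF sub fin[OF A(1)], of "tterm A"] by (simp add: add.commute)
  moreover have "sum (tterm A) (\<Union>F\<in>ray_flats A E e. ?P F E) = (\<Sum>F\<in>ray_flats A E e. sum (tterm A) (?P F E))"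
  proof (rule sum.UNION_disjoint)
    show "finite (ray_flats A E e)" by (rule finite_ray_flats[OF A(1)])
    show "\<forall>F\<in>ray_flats A E e. finite (?P F E)"
      using fin finite_subset[OF ray_flats_ray(6)[OF A(3)] A(1)] by blast
    have "F = F'" if "F \<in> ray_flats A E e" "F' \<in> ray_flats A E e" "S \<in> ?P F E" "S \<in> ?P F' E" for F F' S
      using flat[OF that(1,3)] flat[OF that(2,4)] by simp
    then show "\<forall>F\<in>ray_flats A E e. \<forall>F'\<in>ray_flats A E e. F \<noteq> F' \<longrightarrow> ?P F E \<inter> ?P F' E = {}"
      by blast
  qed
  moreover have "sum (tterm A) (?P F E) = - (fps_X ^ (card (A - F) - 1) * TS F E)"
    if "F \<in> ray_flats A E e" for F
    unfolding TS_def sum_distrib_left sum_negf[symmetric]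
    using tterm_ray_flat[OF A(1,3) that] by (intro sum.cong) auto
  ultimately show ?thesis by (simp add: sum_negf)
qed

text \<open>Pair \<open>S\<close> with \<open>insert e S\<close>. If \<open>e\<close> is not in the
  closure of \<open>S\<close>, the two terms differ only in sign. Otherwise \<open>S\<close> already
  spans and the two add up to the term of \<open>S\<close> in the deletion; for a coloop this never
  happens.\<close>

lemma TS_singleton:
  assumes A: "finite A" "e \<in> A"
  shows "kern (A - {e}) = kern A \<Longrightarrow> TS A {e} = TS (A - {e}) {}"
    and "kern (A - {e}) \<noteq> kern A \<Longrightarrow> TS A {e} = 0"
proof -
  let ?P = "{S. S \<subseteq> A - {e} \<and> kern (insert e S) = kern A}"
  have fin: "finite ?P" by (rule finite_subset[of _ "Pow A"]) (use A in auto)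
  have "{S. S \<subseteq> A \<and> kern (S \<union> {e}) = kern A} = ?P \<union> insert e ` ?P"
  proof (intro equalityI subsetI)
    fix S assume S: "S \<in> {S. S \<subseteq> A \<and> kern (S \<union> {e}) = kern A}"
    show "S \<in> ?P \<union> insert e ` ?P"
    proof (cases "e \<in> S")
      case True
      then have "S = insert e (S - {e})" by auto
      moreover have "S - {e} \<in> ?P" using S True by (auto simp: insert_absorb)
      ultimately show ?thesis by blast
    qed (use S in auto)
  qed (use A in \<open>auto simp: insert_absorb\<close>)
  moreover have "inj_on (insert e) ?P" by (intro inj_onI) auto
  ultimately have TS: "TS A {e} = (\<Sum>S\<in>?P. tterm A S + tterm A (insert e S))"
    unfolding TS_def using fin
    by (simp, subst sum.union_disjoint) (auto simp: sum.reindex sum.distrib)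
  have cancel: "tterm A S + tterm A (insert e S) = 0" if S: "S \<in> ?P" "kern (insert e S) \<noteq> kern S" for S
  proof -
    have finS: "finite S" "e \<notin> S" "insert e S \<subseteq> A" using S A finite_subset[of S A] by auto
    have "rk l (insert e S) = Suc (rk l S)" "card (insert e S) = Suc (card S)"
      using rk_insert[OF finS(1), of e] S finS by auto
    moreover have "rk l (insert e S) \<le> rk l A" "card (insert e S) \<le> card A"
      using rk_mono[OF A(1) finS(3)] card_mono[OF A(1) finS(3)] by auto
    ultimately have "card A - card S - (rk l A - rk l S) = card A - card (insert e S) - (rk l A - rk l (insert e S))"
      "rk l A - rk l S = Suc (rk l A - rk l (insert e S))" "card S - rk l S = card (insert e S) - rk l (insert e S)"
      by auto
    then show ?thesis by (simp add: tterm_def)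
  qed
  show "TS A {e} = 0" if neq: "kern (A - {e}) \<noteq> kern A"
    unfolding TS
  proof (rule sum.neutral, rule ballI)
    fix S assume S: "S \<in> ?P"
    obtain h where h: "h \<in> kern (A - {e})" "h \<notin> kern A"
      using neq kern_mono[of "A - {e}" A] by blast
    then have "h \<in> kern S" using S by (auto simp: kern_def)
    then have "kern (insert e S) \<noteq> kern S" using h S by auto
    then show "tterm A S + tterm A (insert e S) = 0" using cancel[OF S] by blast
  qed
  show "TS A {e} = TS (A - {e}) {}" if k: "kern (A - {e}) = kern A"
    unfolding TS unfolding TS_def
  proof (rule sum.mono_neutral_cong_right)
    show "{S. S \<subseteq> A - {e} \<and> kern (S \<union> {}) = kern (A - {e})} \<subseteq> ?P"
      using k A(2) by (auto simp: kern_insert) (auto simp: kern_def)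
    show "\<forall>S\<in>?P - {S. S \<subseteq> A - {e} \<and> kern (S \<union> {}) = kern (A - {e})}. tterm A S + tterm A (insert e S) = 0"
      using cancel k by auto
    fix S assume "S \<in> {S. S \<subseteq> A - {e} \<and> kern (S \<union> {}) = kern (A - {e})}"
    then have S: "S \<subseteq> A - {e}" "kern S = kern A" using k by auto
    have finS: "finite S" "e \<notin> S" "insert e S \<subseteq> A" using S A finite_subset[of S A] by auto
    have "kern (insert e S) = kern S" using S A(2) by (auto simp: kern_insert) (auto simp: kern_def)
    then have r: "rk l S = rk l A" "rk l (insert e S) = rk l A" "rk l (A - {e}) = rk l A"
      using S A k finS by (auto intro!: rk_eq_if_kern_eq)
    have c: "card (insert e S) = Suc (card S)" "card A = Suc (card (A - {e}))"
      "card S \<le> card (A - {e})" "rk l A \<le> card S"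
      using finS A S rk_le_card[OF finS(1)] r card_mono[of "A - {e}" S] by (auto simp: card_Suc_Diff1 simp del: card_Diff_insert)
    obtain x where x: "card (A - {e}) = card S + x" using c(3) le_iff_add by blast
    have y: "Suc (card S) - rk l A = Suc (card S - rk l A)" using c(4) by simp
    show "tterm A S + tterm A (insert e S) = tterm (A - {e}) S"
      \<comment> \<open>With \<open>k = card S - rk l A\<close> this is
        \<open>X^(x+1) (1-X)^k + X^x (1-X)^(k+1) = X^x (1-X)^k\<close>.\<close>
      unfolding tterm_def r c(1,2) x y by (simp add: algebra_simps)
  qed (use fin in simp)
qed

section \<open>Comparison of the two recursions\<close>

lemma HS_empty: "HS {} {} = 1"
proof -
  have "fun_vs.independent {\<lambda>_::'v. 1 :: complex}"
    by (simp add: fun_vs.independent_insert fun_eq_iff)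
  then have "fun_vs.dim (fun_vs.span {\<lambda>_::'v. 1 :: complex}) = 1"
    by (simp add: fun_vs.dim_span_eq_card_independent del: fun_vs.dim_span)
  then show ?thesis
    by (intro fps_ext) (simp add: HS_def homD_empty dim_0 del: fun_vs.dim_span)
qed

lemma TS_empty: "TS {} {} = 1"
proof -
  have "{S. S \<subseteq> {} \<and> kern (S \<union> {}) = kern {}} = {{}}" by auto
  then show ?thesis by (simp add: TS_def tterm_def rk_empty)
qed

text \<open>Both sides obey one recursion, whose correction terms belong to proper subsets of
  \<open>A\<close>. For fixed nonempty \<open>A\<close>, deletion settles \<open>E = {e}\<close>,
  the recursion leads down to \<open>E = {}\<close>, and from there up to every \<open>E\<close> by
  adding elements one at a time.\<close>

theorem HS_eq_TS:
  assumes "finite A" "E \<subseteq> A"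
  shows "(\<forall>d. findim (homD A E d)) \<and> HS A E = TS A E"
  using assms
proof (induction A arbitrary: E rule: finite_psubset_induct)
  case (psubset A)
  have flats: "F \<subset> A \<and> E \<subseteq> F" if "F \<in> ray_flats A E e" "e \<in> A" for F E e
    using ray_flats_ray[OF that(2,1)] that(2) by auto
  have fin_flats: "findim (homD F E d)" if "F \<in> ray_flats A E e" "e \<in> A" for F E e d
    using flats[OF that] psubset.IH by blast
  have sum_eq: "(\<Sum>F\<in>ray_flats A E e. fps_X ^ (card (A - F) - 1) * HS F E) =
      (\<Sum>F\<in>ray_flats A E e. fps_X ^ (card (A - F) - 1) * TS F E)" if "e \<in> A" for E e
    using flats[OF _ that] psubset.IH by (intro sum.cong refl) metis
  have base: "(\<forall>d. findim (homD A {} d)) \<and> HS A {} = TS A {}"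
  proof (cases "A = {}")
    case True
    have "findim (homD {} {} d)" for d
      unfolding homD_empty using findim_0 unfolding findim_def by (auto intro: exI[of _ "{\<lambda>_. 1}"])
    then show ?thesis using True by (simp add: HS_empty TS_empty)
  next
    case False
    then obtain e where e: "e \<in> A" by blast
    have single: "(\<forall>d. findim (homD A {e} d)) \<and> HS A {e} = TS A {e}"
    proof (cases "kern (A - {e}) = kern A")
      case True
      have "homD A {e} = homD (A - {e}) {}"
        using D_singleton(1)[OF psubset.hyps e True] by (simp add: homD_def[abs_def])
      moreover have "A - {e} \<subset> A" using e by blast
      ultimately show ?thesis
        using psubset.IH[of "A - {e}" "{}"] TS_singleton(1)[OF psubset.hyps e True] by (simp add: HS_def)
    next
      case False
      have "homD A {e} d = {0}" for d
        using D_singleton(2)[OF psubset.hyps e False] by (auto simp: homD_def)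
      then show ?thesis
        using TS_singleton(2)[OF psubset.hyps e False] findim_0
        by (simp add: HS_def dim_0 fps_eq_iff)
    qed
    have fin: "findim (homD A {} d)" for d
      using dim_homD_recursion(1)[of A "{}" e d] psubset.hyps e fin_flats single by simp
    moreover have "HS A {} = TS A {}"
      using HS_recursion[of A "{}" e] TS_recursion[of A "{}" e] psubset.hyps e fin_flats fin single
        sum_eq[OF e, of "{}"] by simp
    ultimately show ?thesis by blast
  qed
  have "finite E" using psubset finite_subset by blast
  then show ?case using \<open>E \<subseteq> A\<close>
  proof (induction E rule: finite_induct)
    case empty
    show ?case by (rule base)
  next
    case (insert e E)
    then have E: "E \<subseteq> A" "e \<in> A" and IH: "\<And>d. findim (homD A E d)" "HS A E = TS A E" by auto
    note fl = fin_flats[OF _ E(2)]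
    have "findim (homD A (insert e E) d)" for d
      using dim_homD_recursion(1)[OF psubset.hyps E fl] IH(1) by blast
    moreover have "HS A (insert e E) = TS A (insert e E)"
      using HS_recursion[OF psubset.hyps E fl IH(1)] TS_recursion[OF psubset.hyps E]
        IH(2) sum_eq[OF E(2), of E] by simp
    ultimately show ?case by blast
  qed
qed

section \<open>Return to the arrangement and its Tutte polynomial\<close>

lemma l_sum: "l i (\<Sum>b\<in>B. f b) = (\<Sum>b\<in>B. l i (f b))"
  by (induction B rule: infinite_finite_induct) (simp_all add: l_0 l_add)

text \<open>Extend a nonzero \<open>h\<close> in the kernel to a basis. The functionals of
  \<open>A\<close> are then combinations of the coordinates other than that of \<open>h\<close>, so
  their rank is below the dimension.\<close>

lemma kern_trivial:
  assumes "finite X" "span X = UNIV" "dim UNIV = rk l A"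
  shows "kern A = {0}"
proof (rule ccontr)
  assume "kern A \<noteq> {0}"
  then obtain h where h: "h \<in> kern A" "h \<noteq> 0" using l_0 by (auto simp: kern_def)
  have "independent {h}" using h(2) by simp
  then obtain B where B: "{h} \<subseteq> B" "B \<subseteq> UNIV" "independent B" "UNIV \<subseteq> span B"
    by (rule maximal_independent_subset_extend[OF subset_UNIV])
  have finB: "finite B" using independent_span_bound[OF assms(1) B(3)] assms(2) by blast
  have cardB: "card B = dim UNIV" using basis_card_eq_dim[of B UNIV] B by simp
  let ?\<phi> = "\<lambda>b v. representation B v b"
  have "l i \<in> fun_vs.span (?\<phi> ` (B - {h}))" if "i \<in> A" for i
  proof -
    have eq: "l i v = (\<Sum>b\<in>B - {h}. l i b * ?\<phi> b v)" for v
    proof -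
      have "(\<Sum>b\<in>B. scale (?\<phi> b v) b) = v"
        using B(4) by (intro sum_representation_eq[OF B(3) _ finB order_refl]) blast
      then have "l i v = l i (\<Sum>b\<in>B. scale (?\<phi> b v) b)" by simp
      also have "\<dots> = (\<Sum>b\<in>B. l i b * ?\<phi> b v)" by (simp add: l_sum l_scale mult.commute)
      also have "\<dots> = (\<Sum>b\<in>B - {h}. l i b * ?\<phi> b v)"
        using h(1) that finB by (intro sum.mono_neutral_right) (auto simp: kern_def)
      finally show ?thesis .
    qed
    have l_eq: "l i = (\<Sum>b\<in>B - {h}. fun_scale (l i b) (?\<phi> b))"
      unfolding fun_eq_iff sum_fun_apply fun_scale_def using eq by blast
    have "(\<Sum>b\<in>B - {h}. fun_scale (l i b) (?\<phi> b)) \<in> fun_vs.span (?\<phi> ` (B - {h}))"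
      by (intro fun_vs.span_sum fun_vs.span_scale fun_vs.span_base) auto
    then show ?thesis unfolding l_eq[symmetric] .
  qed
  then have "rk l A \<le> card (?\<phi> ` (B - {h}))"
    unfolding rk_def using finB by (intro fun_vs.dim_le_card fun_vs.span_minimal) auto
  also have "\<dots> \<le> card (B - {h})" using finB by (intro card_image_le) simp
  also have "\<dots> < card B" using B(1) finB by (intro psubset_card_mono) auto
  finally show False using cardB assms(3) by simp
qed

text \<open>With trivial common kernel every nonzero \<open>h\<close> is seen by some functional, so
  \<open>\<rho> n l h - 1\<close> is an honest subtraction and a strict bound by it means degree at
  most \<open>\<rho> n l h - 2\<close>. The bound 1 at \<open>h = 0\<close> holds for every
  polynomial function.\<close>

lemma Hilb_C_space:
  assumes "kern {1..n} = {0}"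
  shows "Hilb scale (C_space scale n l (- 2)) = HS {1..n} {1..n}"
proof -
  have "f \<in> C_space scale n l (- 2) \<longleftrightarrow> f \<in> D {1..n} {1..n}" for f
  proof -
    have zero: "deg_less 0 (Suc 0) f" if "f \<in> PF" using that by (simp add: deg_less_Suc_0_iff)
    have bnd: "dbound {1..n} {1..n} h = \<rho> n l h - 1 \<and> \<rho> n l h > 0" if "h \<noteq> 0" for h
    proof -
      have "h \<notin> kern {1..n}" using that assms by simp
      then have "\<exists>i\<in>{1..n}. l i h \<noteq> 0" by (auto simp: kern_def)
      moreover from this have "rho {1..n} h > 0" using rho_pos[of "{1..n}"] by blast
      ultimately show ?thesis using \<open>h \<notin> kern {1..n}\<close> by (auto simp: dbound_def rho_def \<rho>_def)
    qed
    have "(p = 0 \<or> int (degree p) \<le> int (\<rho> n l h) + - 2) \<longleftrightarrow> (p = 0 \<or> degree p < dbound {1..n} {1..n} h)"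
      if "h \<noteq> 0" for h and p :: "complex poly"
      using bnd[OF that] by auto
    then have "f \<in> C_space scale n l (- 2) \<longleftrightarrow>
        f \<in> PF \<and> (\<forall>h. h \<noteq> 0 \<longrightarrow> deg_less h (dbound {1..n} {1..n} h) f)"
      unfolding C_space_def by (auto simp: deg_less_iff_ex)
    moreover have "dbound {1..n} {1..n} 0 = 1" using assms by (simp add: dbound_def)
    moreover have "(\<forall>h. h \<noteq> 0 \<longrightarrow> deg_less h (dbound {1..n} {1..n} h) f) \<longleftrightarrow>
        (\<forall>h. deg_less h (dbound {1..n} {1..n} h) f)" if "f \<in> PF"
      using zero[OF that] calculation(2) by (metis One_nat_def)
    ultimately show ?thesis by (auto simp: D_def)
  qed
  then have "C_space scale n l (- 2) \<inter> hom_poly_funs scale d = homD {1..n} {1..n} d" for d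
    unfolding hom_poly_funs_eq homD_def by (auto intro: D_PF)
  then show ?thesis by (simp add: Hilb_def HS_def)
qed

lemma TS_eq_tutte:
  "fps_to_fls (TS {1..n} {1..n}) = fls_X ^ (n - rk l {1..n}) * tutte n l 0 (1 / fls_X)"
proof -
  let ?r = "rk l {1..n}" and ?X = "fls_X :: rat fls"
  have "fps_to_fls (tterm {1..n} S) =
      ?X ^ (n - ?r) * ((0 - 1) ^ (?r - rk l S) * (1 / ?X - 1) ^ (card S - rk l S))"
    if "S \<subseteq> {1..n}" for S
  proof -
    have finS: "finite S" using that finite_subset by blast
    define k where "k = card S - rk l S"
    have le: "rk l S \<le> ?r" "?r + card S \<le> rk l S + n" "rk l S \<le> card S" "card S \<le> n"
      using rk_mono[OF _ that] rk_nullity_mono[OF _ that] rk_le_card[OF finS] card_mono[OF _ that]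
      by auto
    then have e: "card {1..n} - card S - (?r - rk l S) = n - ?r - k" "n - ?r = (n - ?r - k) + k"
      by (auto simp: k_def)
    have "?X * (1 / ?X) = 1" by (metis divide_self fls_X_nonzero mult_1_right times_divide_eq_right)
    then have "?X * (1 / ?X - 1) = 1 - ?X" by (simp only: right_diff_distrib mult_1_right)
    then have p1: "?X ^ k * (1 / ?X - 1) ^ k = (1 - ?X) ^ k"
      by (metis power_mult_distrib)
    have p2: "?X ^ (n - ?r) = ?X ^ (n - ?r - k) * ?X ^ k"
      using e(2) power_add by metis
    have "?X ^ (n - ?r) * ((0 - 1) ^ (?r - rk l S) * (1 / ?X - 1) ^ k) =
        (- 1) ^ (?r - rk l S) * ?X ^ (n - ?r - k) * (1 - ?X) ^ k"
      unfolding p2 p1[symmetric] by (simp only: diff_0 mult_ac)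
    moreover have "fps_to_fls (tterm {1..n} S) = (- 1) ^ (?r - rk l S) * ?X ^ (n - ?r - k) * (1 - ?X) ^ k"
      unfolding tterm_def e(1) k_def[symmetric] by (simp add: fls_times_fps_to_fls fps_to_fls_power)
    ultimately show ?thesis by (simp only: k_def)
  qed
  moreover have "{S. S \<subseteq> {1..n} \<and> kern (S \<union> {1..n}) = kern {1..n}} = Pow {1..n}"
    by (auto simp: Un_absorb1)
  ultimately show ?thesis
    unfolding TS_def tutte_def by (simp add: fps_to_fls_sum sum_distrib_left)
qed

end

text \<open>The hypothesis \<open>essential\<close> makes the common kernel trivial: a nonzero
  \<open>h\<close> in it would have \<open>\<rho> n l h = 0\<close> and force the whole space to be
  zero.\<close>

theorem proposition4p15:
  fixes scale :: "complex \<Rightarrow> 'v::ab_group_add \<Rightarrow> 'v" and Basis :: "'v set"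
    and n r :: nat and l :: "nat \<Rightarrow> 'v \<Rightarrow> complex"
  assumes "finite_dimensional_vector_space scale Basis"
    and "\<And>i. i \<in> {1..n} \<Longrightarrow> functional scale (l i)"
    and "r = rk l {1..n}"
    and essential: "vector_space.dim scale UNIV = r"
  shows "fps_to_fls (Hilb scale (C_space scale n l (-2))) =
           fls_X ^ (n - r) * tutte n l 0 (1 / fls_X)"
proof -
  interpret V: finite_dimensional_vector_space scale Basis by fact
  \<comment> \<open>The locale asks for a functional at every index, so the family is extended by
    zero.\<close>
  define l' where "l' i = (if i \<in> {1..n} then l i else (\<lambda>_. 0))" for i
  have "functional scale (\<lambda>_. 0)" by unfold_locales (simp_all add: algebra_simps)
  then interpret functional_family scale l'
    using assms(2) V.vector_space_axioms
    by (simp add: functional_family_def functional_family_axioms_def complex_space_def l'_def)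
  have l': "l' i = l i" if "i \<in> {1..n}" for i using that by (simp add: l'_def)
  have rk': "rk l' S = rk l S" if "S \<subseteq> {1..n}" for S
  proof -
    have "l' ` S = l ` S" using that l' by (intro image_cong) auto
    then show ?thesis by (simp add: rk_def)
  qed
  have "\<rho> n l' = \<rho> n l" unfolding \<rho>_def using l' by (intro ext arg_cong[where f = card]) auto
  then have C: "C_space scale n l' = C_space scale n l" by (simp add: C_space_def fun_eq_iff)
  have T: "tutte n l' x y = tutte n l x y" for x y :: "rat fls"
    unfolding tutte_def by (intro sum.cong) (simp_all add: rk')
  have r: "r = rk l' {1..n}" using assms(3) rk' by simp
  have "kern {1..n} = {0}"
    using kern_trivial[OF V.finite_Basis V.span_Basis] essential r by simp
  then have "fps_to_fls (Hilb scale (C_space scale n l' (- 2))) =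
      fls_X ^ (n - r) * tutte n l' 0 (1 / fls_X)"
    using HS_eq_TS[of "{1..n}" "{1..n}"] TS_eq_tutte[of n] by (simp add: Hilb_C_space r)
  then show ?thesis by (simp add: C T)
qed

end
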